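(* Let $\mathcal{A}$ be an abelian category and $\mathcal{D}$ an additive category. Assume we have adjunctions $f_!\dashv f^*\dashv f_*$ where $f^*\colon\mathcal{A}\to\mathcal{D}$ is a faithful functor. The following holds: (1) If $\nu\colon\mathcal{A}\to\mathcal{A}$ is a right exact functor such that $\nu\circ f_!=f_*$ and $\nu|_{\operatorname{im}f_!}\colon\operatorname{im}f_!\to\operatorname{im}f_*$ is an isomorphism, then $\nu$ is a Nakayama functor relative to $f_!\dashv f^*$; (2) If, for $\nu$ as in (1), $\nu^-\colon\mathcal{A}\to\mathcal{A}$ is a left exact functor such that $\nu^-\circ f_*=f_!$ and $\nu^-|_{\operatorname{im}f_*}\colon\operatorname{im}f_*\to\operatorname{im}f_!$ is an inverse to $\nu|_{\operatorname{im}f_!}$, then $\nu\dashv\nu^-$; (3) For $\nu$ and $\nu^-$ as in (1) and (2), the unit and counit of $\nu\dashv\nu^-$ are the unique natural transformations $\lambda\colon 1_{\mathcal{A}}\to\nu^-\circ\nu$ and $\sigma\colon\nu\circ\nu^-\to 1_{\mathcal{A}}$ which satisfy $\lambda_{f_!}=1_{f_!}$ and $\sigma_{f_*}=1_{f_*}$.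
   Context: All categories are preadditive and all functors additive. For a functor $F\colon\mathcal{D}\to\mathcal{E}$, $\operatorname{im}F$ is the category with the same objects as $\mathcal{D}$, where a morphism from $D_1$ to $D_2$ is a morphism $F(D_1)\to F(D_2)$ in $\mathcal{E}$. If $\nu\circ f_!=f_*$, then $\nu|_{\operatorname{im}f_!}\colon\operatorname{im}f_!\to\operatorname{im}f_*$ is the functor which is the identity on objects and sends $g\colon f_!(D_1)\to f_!(D_2)$ to $\nu(g)\colon f_*(D_1)\to f_*(D_2)$; similarly for $\nu^-|_{\operatorname{im}f_*}$. For a natural transformation $\eta$ and a functor $G$, $\eta_G$ denotes $\eta$ precomposed with $G$. A Nakayama functor relative to $f_!\dashv f^*$ is a functor $\nu\colon\mathcal{A}\to\mathcal{A}$ with a right adjoint $\nu^-$ such that (i) $\nu\circ f_!$ is right adjoint to $f^*$; (ii) the unit of $\nu\dashv\nu^-$ precomposed with $f_!$ is an isomorphism $f_!\to\nu^-\circ\nu\circ f_!$. *)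

theory Defs
  imports "HOL-Algebra.Group"
begin

section \<open>Preadditive categories\<close>

text \<open>
  Objects and morphisms are carrier sets inside types; every morphism has one domain and one
  codomain. Composition \<^term>\<open>Comp C g f\<close> (first \<open>f\<close>, then \<open>g\<close>) and addition are only meaningful
  on composable, respectively parallel, morphisms.
\<close>

record ('o, 'm) precat =
  Ob   :: "'o set"
  Mor  :: "'m set"
  Dom  :: "'m \<Rightarrow> 'o"
  Cod  :: "'m \<Rightarrow> 'o"
  Id   :: "'o \<Rightarrow> 'm"
  Comp :: "'m \<Rightarrow> 'm \<Rightarrow> 'm"  (infixl "\<odot>\<index>" 70)
  Add  :: "'m \<Rightarrow> 'm \<Rightarrow> 'm"  (infixl "\<uplus>\<index>" 65)
  Zero :: "'o \<Rightarrow> 'o \<Rightarrow> 'm"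

definition Hom :: "('o, 'm) precat \<Rightarrow> 'o \<Rightarrow> 'o \<Rightarrow> 'm set" where
  "Hom C x y = {f \<in> Mor C. Dom C f = x \<and> Cod C f = y}"

definition hom_group :: "('o, 'm) precat \<Rightarrow> 'o \<Rightarrow> 'o \<Rightarrow> 'm monoid" where
  "hom_group C x y = \<lparr>carrier = Hom C x y, monoid.mult = Add C, one = Zero C x y\<rparr>"

locale category =
  fixes C :: "('o, 'm) precat" (structure)
  assumes Dom_closed: "f \<in> Mor C \<Longrightarrow> Dom C f \<in> Ob C"
    and Cod_closed: "f \<in> Mor C \<Longrightarrow> Cod C f \<in> Ob C"
    and Id_closed: "x \<in> Ob C \<Longrightarrow> Id C x \<in> Hom C x x"
    and Comp_closed: "f \<in> Hom C x y \<Longrightarrow> g \<in> Hom C y z \<Longrightarrow> g \<odot> f \<in> Hom C x z"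
    and Comp_Id: "f \<in> Hom C x y \<Longrightarrow> f \<odot> Id C x = f"
    and Id_Comp: "f \<in> Hom C x y \<Longrightarrow> Id C y \<odot> f = f"
    and Comp_assoc:
      "f \<in> Hom C w x \<Longrightarrow> g \<in> Hom C x y \<Longrightarrow> h \<in> Hom C y z \<Longrightarrow> (h \<odot> g) \<odot> f = h \<odot> (g \<odot> f)"

locale preadditive_category = category +
  assumes Hom_comm_group: "x \<in> Ob C \<Longrightarrow> y \<in> Ob C \<Longrightarrow> comm_group (hom_group C x y)"
    and Comp_Add_left:
      "f \<in> Hom C x y \<Longrightarrow> g \<in> Hom C y z \<Longrightarrow> h \<in> Hom C y z \<Longrightarrow> (g \<uplus> h) \<odot> f = (g \<odot> f) \<uplus> (h \<odot> f)"
    and Comp_Add_right: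
      "f \<in> Hom C x y \<Longrightarrow> g \<in> Hom C x y \<Longrightarrow> h \<in> Hom C y z \<Longrightarrow> h \<odot> (f \<uplus> g) = (h \<odot> f) \<uplus> (h \<odot> g)"


section \<open>Additive and abelian categories\<close>

definition is_zero_object :: "('o, 'm) precat \<Rightarrow> 'o \<Rightarrow> bool" where
  "is_zero_object C z \<longleftrightarrow>
     z \<in> Ob C \<and> (\<forall>x\<in>Ob C. (\<exists>!f. f \<in> Hom C x z) \<and> (\<exists>!f. f \<in> Hom C z x))"

definition is_biproduct ::
  "('o, 'm) precat \<Rightarrow> 'o \<Rightarrow> 'o \<Rightarrow> 'o \<Rightarrow> 'm \<Rightarrow> 'm \<Rightarrow> 'm \<Rightarrow> 'm \<Rightarrow> bool" where
  "is_biproduct C x y b i1 i2 p1 p2 \<longleftrightarrow>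
     b \<in> Ob C \<and> i1 \<in> Hom C x b \<and> i2 \<in> Hom C y b \<and> p1 \<in> Hom C b x \<and> p2 \<in> Hom C b y \<and>
     p1 \<odot>\<^bsub>C\<^esub> i1 = Id C x \<and> p2 \<odot>\<^bsub>C\<^esub> i2 = Id C y \<and>
     p2 \<odot>\<^bsub>C\<^esub> i1 = Zero C x y \<and> p1 \<odot>\<^bsub>C\<^esub> i2 = Zero C y x \<and>
     (i1 \<odot>\<^bsub>C\<^esub> p1) \<uplus>\<^bsub>C\<^esub> (i2 \<odot>\<^bsub>C\<^esub> p2) = Id C b"

definition is_mono :: "('o, 'm) precat \<Rightarrow> 'm \<Rightarrow> bool" where
  "is_mono C f \<longleftrightarrow> f \<in> Mor C \<and>
     (\<forall>w\<in>Ob C. \<forall>g\<in>Hom C w (Dom C f). \<forall>h\<in>Hom C w (Dom C f).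
        f \<odot>\<^bsub>C\<^esub> g = f \<odot>\<^bsub>C\<^esub> h \<longrightarrow> g = h)"

definition is_epi :: "('o, 'm) precat \<Rightarrow> 'm \<Rightarrow> bool" where
  "is_epi C f \<longleftrightarrow> f \<in> Mor C \<and>
     (\<forall>z\<in>Ob C. \<forall>g\<in>Hom C (Cod C f) z. \<forall>h\<in>Hom C (Cod C f) z.
        g \<odot>\<^bsub>C\<^esub> f = h \<odot>\<^bsub>C\<^esub> f \<longrightarrow> g = h)"

definition is_iso :: "('o, 'm) precat \<Rightarrow> 'm \<Rightarrow> bool" where
  "is_iso C f \<longleftrightarrow> f \<in> Mor C \<and>
     (\<exists>g\<in>Hom C (Cod C f) (Dom C f).
        g \<odot>\<^bsub>C\<^esub> f = Id C (Dom C f) \<and> f \<odot>\<^bsub>C\<^esub> g = Id C (Cod C f))"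

definition is_kernel :: "('o, 'm) precat \<Rightarrow> 'm \<Rightarrow> 'm \<Rightarrow> bool" where
  "is_kernel C k f \<longleftrightarrow> f \<in> Mor C \<and> k \<in> Mor C \<and> Cod C k = Dom C f \<and>
     f \<odot>\<^bsub>C\<^esub> k = Zero C (Dom C k) (Cod C f) \<and>
     (\<forall>w\<in>Ob C. \<forall>h\<in>Hom C w (Dom C f). f \<odot>\<^bsub>C\<^esub> h = Zero C w (Cod C f) \<longrightarrow>
        (\<exists>!u. u \<in> Hom C w (Dom C k) \<and> k \<odot>\<^bsub>C\<^esub> u = h))"

definition is_cokernel :: "('o, 'm) precat \<Rightarrow> 'm \<Rightarrow> 'm \<Rightarrow> bool" where
  "is_cokernel C c f \<longleftrightarrow> f \<in> Mor C \<and> c \<in> Mor C \<and> Dom C c = Cod C f \<and>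
     c \<odot>\<^bsub>C\<^esub> f = Zero C (Dom C f) (Cod C c) \<and>
     (\<forall>z\<in>Ob C. \<forall>h\<in>Hom C (Cod C f) z. h \<odot>\<^bsub>C\<^esub> f = Zero C (Dom C f) z \<longrightarrow>
        (\<exists>!u. u \<in> Hom C (Cod C c) z \<and> u \<odot>\<^bsub>C\<^esub> c = h))"

locale additive_category = preadditive_category +
  assumes zero_object_exists: "\<exists>z. is_zero_object C z"
    and biproduct_exists:
      "x \<in> Ob C \<Longrightarrow> y \<in> Ob C \<Longrightarrow> \<exists>b i1 i2 p1 p2. is_biproduct C x y b i1 i2 p1 p2"

locale abelian_category = additive_category +
  assumes kernel_exists: "f \<in> Mor C \<Longrightarrow> \<exists>k. is_kernel C k f"
    and cokernel_exists: "f \<in> Mor C \<Longrightarrow> \<exists>c. is_cokernel C c f"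
    and mono_is_kernel: "is_mono C f \<Longrightarrow> \<exists>g. is_kernel C f g"
    and epi_is_cokernel: "is_epi C f \<Longrightarrow> \<exists>g. is_cokernel C f g"

text \<open>
  The image of a morphism is the kernel of its cokernel; \<open>x \<rightarrow> y \<rightarrow> z\<close> is exact at \<open>y\<close> if the image
  of the first morphism is the kernel of the second one, as subobjects of \<open>y\<close>.
\<close>

definition is_image :: "('o, 'm) precat \<Rightarrow> 'm \<Rightarrow> 'm \<Rightarrow> bool" where
  "is_image C i f \<longleftrightarrow> (\<exists>c. is_cokernel C c f \<and> is_kernel C i c)"

definition exact_at :: "('o, 'm) precat \<Rightarrow> 'm \<Rightarrow> 'm \<Rightarrow> bool" where
  "exact_at C f g \<longleftrightarrow> (\<exists>i. is_image C i f \<and> is_kernel C i g)"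


section \<open>Additive functors\<close>

record ('o1, 'm1, 'o2, 'm2) cfunctor =
  fob  :: "'o1 \<Rightarrow> 'o2"
  farr :: "'m1 \<Rightarrow> 'm2"

definition additive_functor ::
  "('o1, 'm1) precat \<Rightarrow> ('o2, 'm2) precat \<Rightarrow> ('o1, 'm1, 'o2, 'm2) cfunctor \<Rightarrow> bool" where
  "additive_functor C D F \<longleftrightarrow>
     (\<forall>x\<in>Ob C. fob F x \<in> Ob D) \<and>
     (\<forall>x\<in>Ob C. \<forall>y\<in>Ob C. \<forall>f\<in>Hom C x y. farr F f \<in> Hom D (fob F x) (fob F y)) \<and>
     (\<forall>x\<in>Ob C. farr F (Id C x) = Id D (fob F x)) \<and>
     (\<forall>x\<in>Ob C. \<forall>y\<in>Ob C. \<forall>z\<in>Ob C. \<forall>f\<in>Hom C x y. \<forall>g\<in>Hom C y z.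
        farr F (g \<odot>\<^bsub>C\<^esub> f) = farr F g \<odot>\<^bsub>D\<^esub> farr F f) \<and>
     (\<forall>x\<in>Ob C. \<forall>y\<in>Ob C. \<forall>f\<in>Hom C x y. \<forall>g\<in>Hom C x y.
        farr F (f \<uplus>\<^bsub>C\<^esub> g) = farr F f \<uplus>\<^bsub>D\<^esub> farr F g)"

text \<open>
  The underlying HOL functions are total, so equality of functors on \<open>C\<close> is agreement on the
  objects and morphisms of \<open>C\<close>.
\<close>

definition functor_eq ::
  "('o1, 'm1) precat \<Rightarrow> ('o1, 'm1, 'o2, 'm2) cfunctor \<Rightarrow> ('o1, 'm1, 'o2, 'm2) cfunctor \<Rightarrow> bool" where
  "functor_eq C F G \<longleftrightarrow>
     (\<forall>x\<in>Ob C. fob F x = fob G x) \<and> (\<forall>f\<in>Mor C. farr F f = farr G f)"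

definition id_functor :: "('o, 'm, 'o, 'm) cfunctor" where
  "id_functor = \<lparr>fob = (\<lambda>x. x), farr = (\<lambda>f. f)\<rparr>"

definition comp_functor ::
  "('o2, 'm2, 'o3, 'm3) cfunctor \<Rightarrow> ('o1, 'm1, 'o2, 'm2) cfunctor \<Rightarrow> ('o1, 'm1, 'o3, 'm3) cfunctor"
  (infixl "\<circ>\<^sub>F" 55) where
  "G \<circ>\<^sub>F F = \<lparr>fob = fob G \<circ> fob F, farr = farr G \<circ> farr F\<rparr>"

definition faithful_functor ::
  "('o1, 'm1) precat \<Rightarrow> ('o2, 'm2) precat \<Rightarrow> ('o1, 'm1, 'o2, 'm2) cfunctor \<Rightarrow> bool" where
  "faithful_functor C D F \<longleftrightarrow> additive_functor C D F \<and>
     (\<forall>x\<in>Ob C. \<forall>y\<in>Ob C. inj_on (farr F) (Hom C x y))"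

text \<open>Preservation of exact sequences \<open>x \<rightarrow> y \<rightarrow> z \<rightarrow> 0\<close>, respectively \<open>0 \<rightarrow> x \<rightarrow> y \<rightarrow> z\<close>.\<close>

definition right_exact_functor ::
  "('o1, 'm1) precat \<Rightarrow> ('o2, 'm2) precat \<Rightarrow> ('o1, 'm1, 'o2, 'm2) cfunctor \<Rightarrow> bool" where
  "right_exact_functor C D F \<longleftrightarrow> additive_functor C D F \<and>
     (\<forall>f g. exact_at C f g \<and> is_epi C g \<longrightarrow>
        exact_at D (farr F f) (farr F g) \<and> is_epi D (farr F g))"

definition left_exact_functor ::
  "('o1, 'm1) precat \<Rightarrow> ('o2, 'm2) precat \<Rightarrow> ('o1, 'm1, 'o2, 'm2) cfunctor \<Rightarrow> bool" where
  "left_exact_functor C D F \<longleftrightarrow> additive_functor C D F \<and>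
     (\<forall>f g. is_mono C f \<and> exact_at C f g \<longrightarrow>
        is_mono D (farr F f) \<and> exact_at D (farr F f) (farr F g))"

definition inverse_functors ::
  "('o1, 'm1) precat \<Rightarrow> ('o2, 'm2) precat \<Rightarrow> ('o1, 'm1, 'o2, 'm2) cfunctor \<Rightarrow>
   ('o2, 'm2, 'o1, 'm1) cfunctor \<Rightarrow> bool" where
  "inverse_functors C D F G \<longleftrightarrow> additive_functor C D F \<and> additive_functor D C G \<and>
     functor_eq C (G \<circ>\<^sub>F F) id_functor \<and> functor_eq D (F \<circ>\<^sub>F G) id_functor"

definition category_isomorphism ::
  "('o1, 'm1) precat \<Rightarrow> ('o2, 'm2) precat \<Rightarrow> ('o1, 'm1, 'o2, 'm2) cfunctor \<Rightarrow> bool" where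
  "category_isomorphism C D F \<longleftrightarrow> (\<exists>G. inverse_functors C D F G)"


section \<open>Natural transformations and adjunctions\<close>

text \<open>A natural transformation is given by its family of components, indexed by objects.\<close>

definition nat_trans ::
  "('o1, 'm1) precat \<Rightarrow> ('o2, 'm2) precat \<Rightarrow> ('o1, 'm1, 'o2, 'm2) cfunctor \<Rightarrow>
   ('o1, 'm1, 'o2, 'm2) cfunctor \<Rightarrow> ('o1 \<Rightarrow> 'm2) \<Rightarrow> bool" where
  "nat_trans C D F G \<tau> \<longleftrightarrow>
     (\<forall>x\<in>Ob C. \<tau> x \<in> Hom D (fob F x) (fob G x)) \<and>
     (\<forall>x\<in>Ob C. \<forall>y\<in>Ob C. \<forall>f\<in>Hom C x y. \<tau> y \<odot>\<^bsub>D\<^esub> farr F f = farr G f \<odot>\<^bsub>D\<^esub> \<tau> x)"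

definition nat_iso ::
  "('o1, 'm1) precat \<Rightarrow> ('o2, 'm2) precat \<Rightarrow> ('o1, 'm1, 'o2, 'm2) cfunctor \<Rightarrow>
   ('o1, 'm1, 'o2, 'm2) cfunctor \<Rightarrow> ('o1 \<Rightarrow> 'm2) \<Rightarrow> bool" where
  "nat_iso C D F G \<tau> \<longleftrightarrow> nat_trans C D F G \<tau> \<and> (\<forall>x\<in>Ob C. is_iso D (\<tau> x))"

definition nat_eq :: "('o1, 'm1) precat \<Rightarrow> ('o1 \<Rightarrow> 'm2) \<Rightarrow> ('o1 \<Rightarrow> 'm2) \<Rightarrow> bool" where
  "nat_eq C \<sigma> \<tau> \<longleftrightarrow> (\<forall>x\<in>Ob C. \<sigma> x = \<tau> x)"

definition id_nat :: "('o2, 'm2) precat \<Rightarrow> ('o1, 'm1, 'o2, 'm2) cfunctor \<Rightarrow> 'o1 \<Rightarrow> 'm2" where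
  "id_nat D F = (\<lambda>x. Id D (fob F x))"

definition precompose :: "('o2 \<Rightarrow> 'm3) \<Rightarrow> ('o1, 'm1, 'o2, 'm2) cfunctor \<Rightarrow> 'o1 \<Rightarrow> 'm3" where
  "precompose \<tau> G = (\<lambda>x. \<tau> (fob G x))"

text \<open>\<open>adjunction C D F G \<eta> \<epsilon>\<close>: \<open>F : C \<rightarrow> D\<close> is left adjoint to \<open>G\<close>, with unit \<open>\<eta>\<close> and counit \<open>\<epsilon>\<close>.\<close>

definition adjunction ::
  "('o1, 'm1) precat \<Rightarrow> ('o2, 'm2) precat \<Rightarrow> ('o1, 'm1, 'o2, 'm2) cfunctor \<Rightarrow>
   ('o2, 'm2, 'o1, 'm1) cfunctor \<Rightarrow> ('o1 \<Rightarrow> 'm1) \<Rightarrow> ('o2 \<Rightarrow> 'm2) \<Rightarrow> bool" where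
  "adjunction C D F G \<eta> \<epsilon> \<longleftrightarrow> additive_functor C D F \<and> additive_functor D C G \<and>
     nat_trans C C id_functor (G \<circ>\<^sub>F F) \<eta> \<and> nat_trans D D (F \<circ>\<^sub>F G) id_functor \<epsilon> \<and>
     (\<forall>x\<in>Ob C. \<epsilon> (fob F x) \<odot>\<^bsub>D\<^esub> farr F (\<eta> x) = Id D (fob F x)) \<and>
     (\<forall>y\<in>Ob D. farr G (\<epsilon> y) \<odot>\<^bsub>C\<^esub> \<eta> (fob G y) = Id C (fob G y))"

definition is_left_adjoint ::
  "('o1, 'm1) precat \<Rightarrow> ('o2, 'm2) precat \<Rightarrow> ('o1, 'm1, 'o2, 'm2) cfunctor \<Rightarrow>
   ('o2, 'm2, 'o1, 'm1) cfunctor \<Rightarrow> bool" where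
  "is_left_adjoint C D F G \<longleftrightarrow> (\<exists>\<eta> \<epsilon>. adjunction C D F G \<eta> \<epsilon>)"


section \<open>The category \<open>im F\<close>\<close>

text \<open>
  For \<open>F : D \<rightarrow> E\<close>, a morphism \<open>x \<rightarrow> y\<close> of \<open>im F\<close> is a morphism \<open>g : F x \<rightarrow> F y\<close> of \<open>E\<close>. It is
  encoded as \<open>(x, g, y)\<close>, because \<open>g\<close> alone does not determine \<open>x\<close> and \<open>y\<close>.
\<close>

definition im_cat ::
  "('o1, 'm1) precat \<Rightarrow> ('o2, 'm2) precat \<Rightarrow> ('o1, 'm1, 'o2, 'm2) cfunctor \<Rightarrow>
   ('o1, 'o1 \<times> 'm2 \<times> 'o1) precat" where
  "im_cat D E F = \<lparr>
     Ob = Ob D,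
     Mor = {(x, g, y). x \<in> Ob D \<and> y \<in> Ob D \<and> g \<in> Hom E (fob F x) (fob F y)},
     Dom = (\<lambda>(x, g, y). x),
     Cod = (\<lambda>(x, g, y). y),
     Id = (\<lambda>x. (x, Id E (fob F x), x)),
     Comp = (\<lambda>(y', h, z) (x, g, y). (x, h \<odot>\<^bsub>E\<^esub> g, z)),
     Add = (\<lambda>(x', h, y') (x, g, y). (x, h \<uplus>\<^bsub>E\<^esub> g, y)),
     Zero = (\<lambda>x y. (x, Zero E (fob F x) (fob F y), y))\<rparr>"

text \<open>If \<open>N \<circ> F = G\<close>, this is the functor \<open>im F \<rightarrow> im G\<close> obtained by restricting \<open>N\<close>.\<close>

definition im_restrict ::
  "('o2, 'm2, 'o3, 'm3) cfunctor \<Rightarrow> ('o1, 'o1 \<times> 'm2 \<times> 'o1, 'o1, 'o1 \<times> 'm3 \<times> 'o1) cfunctor" where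
  "im_restrict N = \<lparr>fob = (\<lambda>x. x), farr = (\<lambda>(x, g, y). (x, farr N g, y))\<rparr>"


section \<open>Nakayama functors\<close>

text \<open>
  \<open>nakayama_functor A D fs fu \<nu>\<close>: \<open>\<nu>\<close> is a Nakayama functor relative to \<open>fs \<stileturn> fu\<close>, where
  \<open>fs : D \<rightarrow> A\<close> and \<open>fu : A \<rightarrow> D\<close>. Right adjoints are unique up to isomorphism, so it does not
  matter which right adjoint \<open>\<nu>'\<close> and which unit \<open>\<eta>\<close> are used.
\<close>

definition nakayama_functor ::
  "('a, 'm) precat \<Rightarrow> ('d, 'n) precat \<Rightarrow> ('d, 'n, 'a, 'm) cfunctor \<Rightarrow> ('a, 'm, 'd, 'n) cfunctor \<Rightarrow>
   ('a, 'm, 'a, 'm) cfunctor \<Rightarrow> bool" where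
  "nakayama_functor A D fs fu \<nu> \<longleftrightarrow>
     (\<exists>\<nu>' \<eta> \<epsilon>. adjunction A A \<nu> \<nu>' \<eta> \<epsilon> \<and>
        is_left_adjoint A D fu (\<nu> \<circ>\<^sub>F fs) \<and>
        nat_iso D A fs (\<nu>' \<circ>\<^sub>F \<nu> \<circ>\<^sub>F fs) (precompose \<eta> fs))"

end

theory Submission
  imports Defs
begin

text \<open>
  Write \<open>L \<stileturn> U \<stileturn> R\<close> for the three given functors and \<open>N\<close>, \<open>M\<close> for \<open>\<nu>\<close>, \<open>\<nu>\<^sup>-\<close>. Faithfulness of \<open>U\<close> makes
  every counit component \<open>\<epsilon> X : L (U X) \<rightarrow> X\<close> an epimorphism (\<open>counit_is_epi\<close>). In an abelian category it is
  then the cokernel of its kernel \<open>K \<rightarrow> L (U X)\<close>, and composing that kernel with the epimorphism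
  \<open>\<epsilon> K\<close> exhibits \<open>X\<close> as the cokernel of a morphism between objects in the image of \<open>L\<close>
  (\<open>counit_is_cokernel\<close>). Dually, the unit \<open>\<eta>' Y : Y \<rightarrow> R (U Y)\<close> exhibits \<open>Y\<close> as the kernel of a
  morphism between objects in the image of \<open>R\<close>. The dual facts are instances of the same lemmas,
  because \<open>R \<stileturn> U\<close> holds between the opposite categories (\<open>faithful_adjunction_op\<close>). Right exactness of
  \<open>N\<close> enters as preservation of epimorphisms, left exactness of \<open>M\<close> as preservation of monomorphisms.

  Existence of a right adjoint of \<open>N\<close>. The presentation of \<open>X\<close> extends the bijection between
  \<open>L c \<rightarrow> L d\<close> and \<open>R c \<rightarrow> R d\<close> given by \<open>N\<close> to a bijection between \<open>X \<rightarrow> L d\<close> and \<open>N X \<rightarrow> R d\<close> for every \<open>X\<close>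
  (\<open>bij_betw_maps_into_image\<close>). So \<open>L d\<close> represents \<open>X \<mapsto> Hom (N X) (R d)\<close>. For arbitrary \<open>Y\<close>, write
  \<open>Y\<close> as the kernel of some \<open>R (U Y) \<rightarrow> R d\<close>, lift this morphism to \<open>v : L (U Y) \<rightarrow> L d\<close>, and take the
  kernel of \<open>v\<close>: it represents \<open>X \<mapsto> Hom (N X) Y\<close> (\<open>universal_arrow_from_kernel\<close>). These representing
  objects assemble to the right adjoint, and comparing the two representations of
  \<open>X \<mapsto> Hom (N X) (R d)\<close> shows that the unit at \<open>L d\<close> is an isomorphism (\<open>unit_is_iso\<close>).

  Unit and counit for mutually inverse restrictions. If an endofunctor \<open>T\<close> restricts to the identity on the
  image of \<open>L\<close>, then a natural transformation \<open>\<tau> : 1 \<rightarrow> T\<close> that is the identity there must satisfy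
  \<open>\<tau> X \<circ> \<epsilon> X = T (\<epsilon> X)\<close>. As \<open>\<epsilon> X\<close> is a cokernel, this equation has exactly one solution, so there is
  exactly one such \<open>\<tau>\<close> (\<open>nat_trans_from_id_exists\<close>, \<open>nat_trans_from_id_unique\<close>). With \<open>T = M \<circ> N\<close> this
  yields the unit, and with \<open>T = N \<circ> M\<close> in the opposite category the counit. The triangle identities
  can be tested after composition with \<open>N (\<epsilon> X)\<close> and \<open>M (\<eta>' Y)\<close>, where naturality reduces them to the
  images of \<open>L\<close> and \<open>R\<close> (\<open>adjunction_of_inverses_on_images\<close>).
\<close>

section \<open>Morphisms in preadditive categories\<close>

context category
begin

lemma HomD:
  assumes "f \<in> Hom C x y"
  shows "x \<in> Ob C" and "y \<in> Ob C" and "f \<in> Mor C" and "Dom C f = x" and "Cod C f = y"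
  using assms Dom_closed Cod_closed unfolding Hom_def by auto

lemma in_Hom: "f \<in> Mor C \<Longrightarrow> f \<in> Hom C (Dom C f) (Cod C f)"
  unfolding Hom_def by simp

lemma monoD:
  assumes "is_mono C m" "m \<in> Hom C x y" "g \<in> Hom C w x" "h \<in> Hom C w x" "m \<odot> g = m \<odot> h"
  shows "g = h"
  using assms HomD unfolding is_mono_def by metis

lemma epiD:
  assumes "is_epi C p" "p \<in> Hom C x y" "g \<in> Hom C y z" "h \<in> Hom C y z" "g \<odot> p = h \<odot> p"
  shows "g = h"
  using assms HomD unfolding is_epi_def by metis

lemma monoI:
  assumes "m \<in> Hom C x y"
    and "\<And>w g h. g \<in> Hom C w x \<Longrightarrow> h \<in> Hom C w x \<Longrightarrow> m \<odot> g = m \<odot> h \<Longrightarrow> g = h"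
  shows "is_mono C m"
  using assms HomD unfolding is_mono_def by metis

lemma epiI:
  assumes "p \<in> Hom C x y"
    and "\<And>z g h. g \<in> Hom C y z \<Longrightarrow> h \<in> Hom C y z \<Longrightarrow> g \<odot> p = h \<odot> p \<Longrightarrow> g = h"
  shows "is_epi C p"
  using assms HomD unfolding is_epi_def by metis

end

context preadditive_category
begin

lemma Zero_closed: "x \<in> Ob C \<Longrightarrow> y \<in> Ob C \<Longrightarrow> Zero C x y \<in> Hom C x y"
  using monoid.one_closed[OF comm_monoid.axioms(1), OF comm_group.axioms(1), OF Hom_comm_group]
  by (simp add: hom_group_def)

lemma Add_closed:
  assumes "f \<in> Hom C x y" "g \<in> Hom C x y"
  shows "f \<uplus> g \<in> Hom C x y"
proof -
  interpret comm_group "hom_group C x y"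
    using assms(1) by (intro Hom_comm_group HomD)
  show ?thesis
    using assms m_closed[of f g] by (simp add: hom_group_def)
qed

lemma Zero_Add_Zero: "x \<in> Ob C \<Longrightarrow> y \<in> Ob C \<Longrightarrow> Zero C x y \<uplus> Zero C x y = Zero C x y"
  using monoid.l_one[OF comm_monoid.axioms(1), OF comm_group.axioms(1), OF Hom_comm_group]
  by (simp add: hom_group_def Zero_closed)

lemma idempotent_is_Zero:
  assumes "f \<in> Hom C x y" "f \<uplus> f = f"
  shows "f = Zero C x y"
proof -
  interpret comm_group "hom_group C x y"
    using assms(1) by (intro Hom_comm_group HomD)
  show ?thesis
    using assms l_cancel_one[of f f] by (simp add: hom_group_def)
qed

lemma Comp_Zero:
  assumes "h \<in> Hom C y z" "x \<in> Ob C"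
  shows "h \<odot> Zero C x y = Zero C x z"
proof (rule idempotent_is_Zero)
  have 0: "Zero C x y \<in> Hom C x y"
    using assms(2) HomD(1)[OF assms(1)] by (rule Zero_closed)
  show "h \<odot> Zero C x y \<in> Hom C x z"
    using Comp_closed[OF 0 assms(1)] .
  show "(h \<odot> Zero C x y) \<uplus> (h \<odot> Zero C x y) = h \<odot> Zero C x y"
    using Comp_Add_right[OF 0 0 assms(1)] Zero_Add_Zero HomD[OF 0] by simp
qed

lemma Zero_Comp:
  assumes "h \<in> Hom C x y" "z \<in> Ob C"
  shows "Zero C y z \<odot> h = Zero C x z"
proof (rule idempotent_is_Zero)
  have 0: "Zero C y z \<in> Hom C y z"
    using HomD(2)[OF assms(1)] assms(2) by (rule Zero_closed)
  show "Zero C y z \<odot> h \<in> Hom C x z"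
    using Comp_closed[OF assms(1) 0] .
  show "(Zero C y z \<odot> h) \<uplus> (Zero C y z \<odot> h) = Zero C y z \<odot> h"
    using Comp_Add_left[OF assms(1) 0 0] Zero_Add_Zero HomD[OF 0] by simp
qed

lemma kernelD:
  assumes "is_kernel C k f" "f \<in> Hom C x y"
  shows "k \<in> Hom C (Dom C k) x" and "f \<odot> k = Zero C (Dom C k) y"
    and "\<And>w h. h \<in> Hom C w x \<Longrightarrow> f \<odot> h = Zero C w y \<Longrightarrow> \<exists>u\<in>Hom C w (Dom C k). k \<odot> u = h"
proof -
  show "k \<in> Hom C (Dom C k) x" and "f \<odot> k = Zero C (Dom C k) y"
    using assms unfolding is_kernel_def Hom_def by auto
  show "\<exists>u\<in>Hom C w (Dom C k). k \<odot> u = h" if "h \<in> Hom C w x" "f \<odot> h = Zero C w y" for w h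
    using assms(1) HomD(4,5)[OF assms(2)] HomD(1)[OF that(1)] that unfolding is_kernel_def by blast
qed

lemma kernel_is_mono:
  assumes "is_kernel C k f"
  shows "is_mono C k"
proof (rule monoI)
  let ?x = "Dom C f" and ?y = "Cod C f"
  have f: "f \<in> Hom C ?x ?y"
    using assms in_Hom unfolding is_kernel_def by blast
  show k: "k \<in> Hom C (Dom C k) ?x"
    using kernelD(1)[OF assms f] .
  fix w g h
  assume g: "g \<in> Hom C w (Dom C k)" and h: "h \<in> Hom C w (Dom C k)" and eq: "k \<odot> g = k \<odot> h"
  have w: "w \<in> Ob C" using HomD(1)[OF g] .
  have "f \<odot> (k \<odot> g) = Zero C (Dom C k) ?y \<odot> g"
    using Comp_assoc[OF g k f] kernelD(2)[OF assms f] by simp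
  also have "\<dots> = Zero C w ?y"
    using Zero_Comp[OF g] HomD(2)[OF f] .
  finally have "\<exists>!u. u \<in> Hom C w (Dom C k) \<and> k \<odot> u = k \<odot> g"
    using assms w Comp_closed[OF g k] unfolding is_kernel_def by blast
  from the1_equality[OF this, of g] the1_equality[OF this, of h] g h eq show "g = h" by simp
qed

end

section \<open>The opposite category\<close>

text \<open>
  Duality is used to pass from the counit of \<open>f\<^sub>! \<stileturn> f\<^sup>*\<close> to the unit of \<open>f\<^sup>* \<stileturn> f\<^sub>*\<close>. The simplification
  rules below translate each notion for the opposite category back to the dual notion for the original one.
\<close>

definition op_cat :: "('o, 'm) precat \<Rightarrow> ('o, 'm) precat" where
  "op_cat C = C\<lparr>Dom := Cod C, Cod := Dom C, Comp := (\<lambda>g f. f \<odot>\<^bsub>C\<^esub> g), Zero := (\<lambda>x y. Zero C y x)\<rparr>"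

lemma op_cat_simps [simp]:
  "Ob (op_cat C) = Ob C" "Mor (op_cat C) = Mor C" "Dom (op_cat C) = Cod C" "Cod (op_cat C) = Dom C"
  "Id (op_cat C) = Id C" "g \<odot>\<^bsub>op_cat C\<^esub> f = f \<odot>\<^bsub>C\<^esub> g" "Add (op_cat C) = Add C"
  "Zero (op_cat C) x y = Zero C y x"
  by (simp_all add: op_cat_def)

lemma Hom_op [simp]: "Hom (op_cat C) x y = Hom C y x"
  by (auto simp: Hom_def)

lemma op_op [simp]: "op_cat (op_cat C) = C"
  by (simp add: op_cat_def)

lemma hom_group_op [simp]: "hom_group (op_cat C) x y = hom_group C y x"
  by (simp add: hom_group_def)

lemma is_mono_op [simp]: "is_mono (op_cat C) f \<longleftrightarrow> is_epi C f"
  by (simp add: is_mono_def is_epi_def)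

lemma is_epi_op [simp]: "is_epi (op_cat C) f \<longleftrightarrow> is_mono C f"
  by (simp add: is_mono_def is_epi_def)

lemma is_kernel_op [simp]: "is_kernel (op_cat C) k f \<longleftrightarrow> is_cokernel C k f"
  by (simp add: is_kernel_def is_cokernel_def)

lemma is_cokernel_op [simp]: "is_cokernel (op_cat C) k f \<longleftrightarrow> is_kernel C k f"
  by (simp add: is_kernel_def is_cokernel_def)

lemma is_zero_object_op [simp]: "is_zero_object (op_cat C) z \<longleftrightarrow> is_zero_object C z"
  by (auto simp: is_zero_object_def)

lemma is_biproduct_op:
  "is_biproduct C x y b i1 i2 p1 p2 \<Longrightarrow> is_biproduct (op_cat C) x y b p1 p2 i1 i2"
  by (simp add: is_biproduct_def)

lemma category_op: "category C \<Longrightarrow> category (op_cat C)"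
  unfolding category_def by (auto simp: Hom_def)

lemma preadditive_category_op: "preadditive_category C \<Longrightarrow> preadditive_category (op_cat C)"
  unfolding preadditive_category_def preadditive_category_axioms_def hom_group_op Hom_op op_cat_simps
  using category_op by blast

lemma additive_category_op:
  assumes "additive_category C"
  shows "additive_category (op_cat C)"
proof -
  interpret additive_category C by fact
  show ?thesis
  proof (intro additive_category.intro additive_category_axioms.intro)
    show "preadditive_category (op_cat C)"
      using preadditive_category_axioms by (rule preadditive_category_op)
    show "\<exists>z. is_zero_object (op_cat C) z"
      using zero_object_exists by simp
    show "\<exists>b i1 i2 p1 p2. is_biproduct (op_cat C) x y b i1 i2 p1 p2"
      if xy: "x \<in> Ob (op_cat C)" "y \<in> Ob (op_cat C)" for x y
    proof -
      obtain b i1 i2 p1 p2 where biproduct: "is_biproduct C x y b i1 i2 p1 p2"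
        using biproduct_exists xy unfolding op_cat_simps by blast
      show ?thesis
        using is_biproduct_op[OF biproduct] by blast
    qed
  qed
qed

lemma abelian_category_op:
  assumes "abelian_category C"
  shows "abelian_category (op_cat C)"
proof -
  interpret abelian_category C by fact
  show ?thesis
    using additive_category_op[OF additive_category_axioms] kernel_exists cokernel_exists
      mono_is_kernel epi_is_cokernel
    by (simp add: abelian_category_def abelian_category_axioms_def)
qed

lemma additive_functor_op:
  "additive_functor C D F \<Longrightarrow> additive_functor (op_cat C) (op_cat D) F"
  by (simp add: additive_functor_def)

lemma faithful_functor_op:
  "faithful_functor C D F \<Longrightarrow> faithful_functor (op_cat C) (op_cat D) F"
  by (simp add: faithful_functor_def additive_functor_op)

lemma nat_trans_op: "nat_trans C D F G \<tau> \<Longrightarrow> nat_trans (op_cat C) (op_cat D) G F \<tau>"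
  by (simp add: nat_trans_def)

lemma adjunction_op:
  "adjunction C D F G \<eta> \<epsilon> \<Longrightarrow> adjunction (op_cat D) (op_cat C) G F \<epsilon> \<eta>"
  by (auto simp: adjunction_def additive_functor_op nat_trans_op)

section \<open>Monomorphisms and epimorphisms in abelian categories\<close>

context abelian_category
begin

text \<open>
  If \<open>m\<close> is a kernel of \<open>g\<close>, then \<open>g\<close> factors through the cokernel \<open>c\<close> of \<open>m\<close>; hence everything killed by
  \<open>c\<close> is killed by \<open>g\<close> and factors through \<open>m\<close>.
\<close>

lemma mono_is_kernel_of_cokernel:
  assumes m: "is_mono C m" and c: "is_cokernel C c m"
  shows "is_kernel C m c"
proof -
  let ?x = "Dom C m" and ?y = "Cod C m" and ?z = "Cod C c"
  have m_hom: "m \<in> Hom C ?x ?y" and c_hom: "c \<in> Hom C ?y ?z" and cm: "c \<odot> m = Zero C ?x ?z"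
    using m c unfolding is_mono_def is_cokernel_def Hom_def by auto
  obtain g where g: "is_kernel C m g"
    using mono_is_kernel[OF m] by blast
  let ?t = "Cod C g"
  have g_hom: "g \<in> Hom C ?y ?t"
    using g unfolding is_kernel_def Hom_def by auto
  have "g \<odot> m = Zero C ?x ?t"
    using kernelD(2)[OF g g_hom] .
  then obtain v where v: "v \<in> Hom C ?z ?t" "v \<odot> c = g"
    using c g_hom HomD(2)[OF g_hom] unfolding is_cokernel_def by blast
  have "\<exists>!u. u \<in> Hom C w ?x \<and> m \<odot> u = h"
    if h: "h \<in> Hom C w ?y" and ch: "c \<odot> h = Zero C w ?z" for w h
  proof -
    have "g \<odot> h = Zero C w ?t"
      using Comp_assoc[OF h c_hom v(1)] ch v(2) Comp_Zero[OF v(1)] HomD(1)[OF h] by simp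
    then obtain u where u: "u \<in> Hom C w ?x" "m \<odot> u = h"
      using kernelD(3)[OF g g_hom h] by blast
    then show ?thesis
      using monoD[OF m m_hom] by blast
  qed
  moreover have "Dom C c = ?y"
    using HomD[OF c_hom] by simp
  ultimately show ?thesis
    using cm HomD[OF m_hom] HomD[OF c_hom] unfolding is_kernel_def by simp
qed

lemma mono_exact_cokernel:
  assumes "is_mono C m" "is_cokernel C c m"
  shows "exact_at C m c"
  using mono_is_kernel_of_cokernel[OF assms] assms unfolding exact_at_def is_image_def by blast

lemma epi_is_cokernel_of_kernel:
  assumes "is_epi C p" "is_kernel C k p"
  shows "is_cokernel C p k"
  using abelian_category.mono_is_kernel_of_cokernel[OF abelian_category_op, OF abelian_category_axioms]
    assms by simp

lemma kernel_exact_epi: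
  assumes "is_epi C p" "is_kernel C k p"
  shows "exact_at C k p"
  using epi_is_cokernel_of_kernel[OF assms] assms unfolding exact_at_def is_image_def by blast

text \<open>
  A monomorphism is completed by its cokernel, and an epimorphism by its kernel, to an exact sequence
  to which the exactness hypothesis applies.
\<close>

lemma left_exact_preserves_mono:
  assumes "left_exact_functor C D F" and m: "is_mono C m"
  shows "is_mono D (farr F m)"
proof -
  obtain c where "is_cokernel C c m"
    using cokernel_exists m unfolding is_mono_def by blast
  then show ?thesis
    using mono_exact_cokernel[OF m] m assms(1) unfolding left_exact_functor_def by blast
qed

lemma right_exact_preserves_epi:
  assumes "right_exact_functor C D F" and p: "is_epi C p"
  shows "is_epi D (farr F p)"
proof -
  obtain k where "is_kernel C k p"
    using kernel_exists p unfolding is_epi_def by blast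
  then show ?thesis
    using kernel_exact_epi[OF p] p assms(1) unfolding right_exact_functor_def by blast
qed

end

section \<open>Additive functors and adjunctions\<close>

lemma fob_comp [simp]: "fob (G \<circ>\<^sub>F F) x = fob G (fob F x)"
  and farr_comp [simp]: "farr (G \<circ>\<^sub>F F) f = farr G (farr F f)"
  by (simp_all add: comp_functor_def)

lemma fob_id [simp]: "fob id_functor x = x" and farr_id [simp]: "farr id_functor f = f"
  by (simp_all add: id_functor_def)

context category
begin

lemma functor_Ob: "additive_functor C D F \<Longrightarrow> x \<in> Ob C \<Longrightarrow> fob F x \<in> Ob D"
  by (simp add: additive_functor_def)

lemma functor_Hom: "additive_functor C D F \<Longrightarrow> f \<in> Hom C x y \<Longrightarrow> farr F f \<in> Hom D (fob F x) (fob F y)"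
  using HomD(1,2)[of f x y] by (simp add: additive_functor_def)

lemma functor_Id: "additive_functor C D F \<Longrightarrow> x \<in> Ob C \<Longrightarrow> farr F (Id C x) = Id D (fob F x)"
  by (simp add: additive_functor_def)

lemma functor_Comp:
  "additive_functor C D F \<Longrightarrow> f \<in> Hom C x y \<Longrightarrow> g \<in> Hom C y z \<Longrightarrow>
    farr F (g \<odot> f) = farr F g \<odot>\<^bsub>D\<^esub> farr F f"
  using HomD(1,2)[of f x y] HomD(2)[of g y z] unfolding additive_functor_def by blast

lemma functor_Add:
  "additive_functor C D F \<Longrightarrow> f \<in> Hom C x y \<Longrightarrow> g \<in> Hom C x y \<Longrightarrow>
    farr F (f \<uplus> g) = farr F f \<uplus>\<^bsub>D\<^esub> farr F g"
  using HomD(1,2)[of f x y] unfolding additive_functor_def by blast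

lemma nat_trans_Hom: "nat_trans C D F G \<tau> \<Longrightarrow> x \<in> Ob C \<Longrightarrow> \<tau> x \<in> Hom D (fob F x) (fob G x)"
  by (simp add: nat_trans_def)

lemma nat_trans_natural:
  "nat_trans C D F G \<tau> \<Longrightarrow> f \<in> Hom C x y \<Longrightarrow> \<tau> y \<odot>\<^bsub>D\<^esub> farr F f = farr G f \<odot>\<^bsub>D\<^esub> \<tau> x"
  using HomD(1,2)[of f x y] unfolding nat_trans_def by blast

lemma additive_functor_comp:
  assumes F: "additive_functor C D F" and G: "additive_functor D E G" and "category D"
  shows "additive_functor C E (G \<circ>\<^sub>F F)"
proof -
  interpret D: category D by fact
  show ?thesis
    unfolding additive_functor_def
    using functor_Ob[OF F] functor_Hom[OF F] functor_Id[OF F] functor_Comp[OF F] functor_Add[OF F]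
    by (auto simp: D.functor_Ob[OF G] D.functor_Hom[OF G] D.functor_Id[OF G]
        D.functor_Comp[OF G functor_Hom[OF F] functor_Hom[OF F]]
        D.functor_Add[OF G functor_Hom[OF F] functor_Hom[OF F]])
qed

end

lemma functor_Zero:
  assumes "preadditive_category C" "preadditive_category D" and F: "additive_functor C D F"
    and "x \<in> Ob C" "y \<in> Ob C"
  shows "farr F (Zero C x y) = Zero D (fob F x) (fob F y)"
proof -
  interpret C: preadditive_category C by fact
  interpret D: preadditive_category D by fact
  have 0: "Zero C x y \<in> Hom C x y"
    using C.Zero_closed assms by blast
  show ?thesis
    using D.idempotent_is_Zero[OF C.functor_Hom[OF F 0]] C.functor_Add[OF F 0 0]
      C.Zero_Add_Zero assms(4,5) by metis
qed


lemma adjunctionD: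
  assumes "adjunction C D F G \<eta> \<epsilon>"
  shows "additive_functor C D F" and "additive_functor D C G"
    and "nat_trans C C id_functor (G \<circ>\<^sub>F F) \<eta>" and "nat_trans D D (F \<circ>\<^sub>F G) id_functor \<epsilon>"
    and "x \<in> Ob C \<Longrightarrow> \<epsilon> (fob F x) \<odot>\<^bsub>D\<^esub> farr F (\<eta> x) = Id D (fob F x)"
    and "y \<in> Ob D \<Longrightarrow> farr G (\<epsilon> y) \<odot>\<^bsub>C\<^esub> \<eta> (fob G y) = Id C (fob G y)"
  using assms unfolding adjunction_def by auto

lemma functor_eqD:
  assumes "functor_eq C F G"
  shows "x \<in> Ob C \<Longrightarrow> fob F x = fob G x" and "f \<in> Hom C x y \<Longrightarrow> farr F f = farr G f"
  using assms unfolding functor_eq_def Hom_def by auto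

lemma additive_functor_cong:
  assumes "functor_eq C F G"
    and "preadditive_category C" and F: "additive_functor C D F"
  shows "additive_functor C D G"
proof -
  interpret C: preadditive_category C by fact
  note [simp] = functor_eqD[OF assms(1), symmetric]
  show ?thesis
    unfolding additive_functor_def
  proof (intro conjI ballI)
    fix x y f assume "x \<in> Ob C" "y \<in> Ob C" "f \<in> Hom C x y"
    then show "farr G f \<in> Hom D (fob G x) (fob G y)"
      using C.functor_Hom[OF F] by simp
  next
    fix x assume x: "x \<in> Ob C"
    show "fob G x \<in> Ob D"
      using x C.functor_Ob[OF F] by simp
    show "farr G (Id C x) = Id D (fob G x)"
      using x C.functor_Id[OF F x] functor_eqD(2)[OF assms(1) C.Id_closed[OF x]] by simp
  next
    fix x y z f g
    assume f: "f \<in> Hom C x y" and g: "g \<in> Hom C y z"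
    show "farr G (g \<odot>\<^bsub>C\<^esub> f) = farr G g \<odot>\<^bsub>D\<^esub> farr G f"
      using C.functor_Comp[OF F f g] functor_eqD(2)[OF assms(1)] f g C.Comp_closed[OF f g] by metis
  next
    fix x y f g
    assume f: "f \<in> Hom C x y" and g: "g \<in> Hom C x y"
    show "farr G (f \<uplus>\<^bsub>C\<^esub> g) = farr G f \<uplus>\<^bsub>D\<^esub> farr G g"
      using C.functor_Add[OF F f g] functor_eqD(2)[OF assms(1)] f g C.Add_closed[OF f g]
      by metis
  qed
qed

text \<open>
  The universal arrow \<open>e y : F (r y) \<rightarrow> y\<close> becomes the counit. A morphism \<open>h : F x \<rightarrow> y\<close> has a unique
  transpose \<open>x \<rightarrow> r y\<close>, and two morphisms into \<open>r y\<close> agree once their composites with \<open>e y\<close> do. Each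
  functor, naturality and triangle law for \<open>r\<close> is an equation that is checked in this way.
\<close>

lemma right_adjoint_from_universal_arrows:
  assumes "preadditive_category C" "preadditive_category D" and F: "additive_functor C D F"
    and universal: "\<And>y. y \<in> Ob D \<Longrightarrow> \<exists>r\<in>Ob C. \<exists>e\<in>Hom D (fob F r) y.
      \<forall>x\<in>Ob C. \<forall>h\<in>Hom D (fob F x) y. \<exists>!g. g \<in> Hom C x r \<and> e \<odot>\<^bsub>D\<^esub> farr F g = h"
  shows "\<exists>G \<eta> \<epsilon>. adjunction C D F G \<eta> \<epsilon>"
proof -
  interpret C: preadditive_category C by fact
  interpret D: preadditive_category D by fact
  obtain r e where r: "\<And>y. y \<in> Ob D \<Longrightarrow> r y \<in> Ob C"
    and e: "\<And>y. y \<in> Ob D \<Longrightarrow> e y \<in> Hom D (fob F (r y)) y"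
    and ex1: "\<And>y x h. \<lbrakk>y \<in> Ob D; x \<in> Ob C; h \<in> Hom D (fob F x) y\<rbrakk> \<Longrightarrow>
      \<exists>!g. g \<in> Hom C x (r y) \<and> e y \<odot>\<^bsub>D\<^esub> farr F g = h"
    using universal by metis
  define tr where "tr x y h = (THE g. g \<in> Hom C x (r y) \<and> e y \<odot>\<^bsub>D\<^esub> farr F g = h)" for x y h
  have tr: "tr x y h \<in> Hom C x (r y)" "e y \<odot>\<^bsub>D\<^esub> farr F (tr x y h) = h"
    if "x \<in> Ob C" "h \<in> Hom D (fob F x) y" for x y h
    using theI'[OF ex1[OF D.HomD(2)[OF that(2)] that]] unfolding tr_def by auto
  have cancel: "g = g'"
    if g: "g \<in> Hom C x (r y)" "g' \<in> Hom C x (r y)" and y: "y \<in> Ob D"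
      and eq: "e y \<odot>\<^bsub>D\<^esub> farr F g = e y \<odot>\<^bsub>D\<^esub> farr F g'" for x y g g'
  proof -
    have "e y \<odot>\<^bsub>D\<^esub> farr F g \<in> Hom D (fob F x) y"
      using D.Comp_closed[OF C.functor_Hom[OF F g(1)] e[OF y]] .
    from ex1[OF y C.HomD(1)[OF g(1)] this] show ?thesis
      using g eq by metis
  qed
  have F_Comp: "e y \<odot>\<^bsub>D\<^esub> farr F (h \<odot>\<^bsub>C\<^esub> g) = (e y \<odot>\<^bsub>D\<^esub> farr F h) \<odot>\<^bsub>D\<^esub> farr F g"
    if "g \<in> Hom C x z" "h \<in> Hom C z (r y)" "y \<in> Ob D" for x y z g h
    using D.Comp_assoc[OF C.functor_Hom[OF F that(1)] C.functor_Hom[OF F that(2)] e[OF that(3)]]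
      C.functor_Comp[OF F that(1,2)] by simp

  define G :: "('c, 'd, 'a, 'b) cfunctor" where
    "G = \<lparr>fob = r, farr = (\<lambda>f. tr (r (Dom D f)) (Cod D f) (f \<odot>\<^bsub>D\<^esub> e (Dom D f)))\<rparr>"
  have G_Ob: "fob G y = r y" for y
    by (simp add: G_def)
  have G: "farr G f \<in> Hom C (r y) (r y')" "e y' \<odot>\<^bsub>D\<^esub> farr F (farr G f) = f \<odot>\<^bsub>D\<^esub> e y"
    if f: "f \<in> Hom D y y'" for f y y'
    using tr[OF r[OF D.HomD(1)[OF f]] D.Comp_closed[OF e[OF D.HomD(1)[OF f]] f]] D.HomD(4,5)[OF f]
    by (simp_all add: G_def)
  have G_additive: "additive_functor D C G"
    unfolding additive_functor_def G_Ob
  proof (intro conjI ballI)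
    fix y assume y: "y \<in> Ob D"
    show "r y \<in> Ob C" using r[OF y] .
    show "farr G (Id D y) = Id C (r y)"
    proof (rule cancel[OF _ _ y])
      show "farr G (Id D y) \<in> Hom C (r y) (r y)" using G(1)[OF D.Id_closed[OF y]] .
      show "Id C (r y) \<in> Hom C (r y) (r y)" using C.Id_closed[OF r[OF y]] .
      show "e y \<odot>\<^bsub>D\<^esub> farr F (farr G (Id D y)) = e y \<odot>\<^bsub>D\<^esub> farr F (Id C (r y))"
        using G(2)[OF D.Id_closed[OF y]] C.functor_Id[OF F r[OF y]] D.Comp_Id[OF e[OF y]]
          D.Id_Comp[OF e[OF y]] by simp
    qed
  next
    fix x y f assume "f \<in> Hom D x y"
    then show "farr G f \<in> Hom C (r x) (r y)" using G(1) by simp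
  next
    fix x y z f g assume f: "f \<in> Hom D x y" and g: "g \<in> Hom D y z"
    have xyz: "x \<in> Ob D" "y \<in> Ob D" "z \<in> Ob D"
      using D.HomD(1,2)[OF f] D.HomD(2)[OF g] by auto
    note gf = D.Comp_closed[OF f g]
    show "farr G (g \<odot>\<^bsub>D\<^esub> f) = farr G g \<odot>\<^bsub>C\<^esub> farr G f"
    proof (rule cancel[OF G(1)[OF gf] C.Comp_closed[OF G(1)[OF f] G(1)[OF g]] xyz(3)])
      show "e z \<odot>\<^bsub>D\<^esub> farr F (farr G (g \<odot>\<^bsub>D\<^esub> f)) = e z \<odot>\<^bsub>D\<^esub> farr F (farr G g \<odot>\<^bsub>C\<^esub> farr G f)"
        using G(2)[OF gf] G(2)[OF g] G(2)[OF f] F_Comp[OF G(1)[OF f] G(1)[OF g] xyz(3)]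
          D.Comp_assoc[OF C.functor_Hom[OF F G(1)[OF f]] e[OF xyz(2)] g]
          D.Comp_assoc[OF e[OF xyz(1)] f g] by simp
    qed
  next
    fix x y f g assume f: "f \<in> Hom D x y" and g: "g \<in> Hom D x y"
    have xy: "x \<in> Ob D" "y \<in> Ob D"
      using D.HomD(1,2)[OF f] by auto
    note fg = D.Add_closed[OF f g]
    note Gfg = C.Add_closed[OF G(1)[OF f] G(1)[OF g]]
    show "farr G (f \<uplus>\<^bsub>D\<^esub> g) = farr G f \<uplus>\<^bsub>C\<^esub> farr G g"
    proof (rule cancel[OF G(1)[OF fg] Gfg xy(2)])
      show "e y \<odot>\<^bsub>D\<^esub> farr F (farr G (f \<uplus>\<^bsub>D\<^esub> g)) = e y \<odot>\<^bsub>D\<^esub> farr F (farr G f \<uplus>\<^bsub>C\<^esub> farr G g)"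
        using G(2)[OF fg] G(2)[OF f] G(2)[OF g] C.functor_Add[OF F G(1)[OF f] G(1)[OF g]]
          D.Comp_Add_left[OF e[OF xy(1)] f g]
          D.Comp_Add_right[OF C.functor_Hom[OF F G(1)[OF f]] C.functor_Hom[OF F G(1)[OF g]] e[OF xy(2)]]
        by simp
    qed
  qed

  define \<eta> where "\<eta> x = tr x (fob F x) (Id D (fob F x))" for x
  have \<eta>: "\<eta> x \<in> Hom C x (r (fob F x))" "e (fob F x) \<odot>\<^bsub>D\<^esub> farr F (\<eta> x) = Id D (fob F x)"
    if "x \<in> Ob C" for x
    using tr[OF that D.Id_closed[OF C.functor_Ob[OF F that]]] unfolding \<eta>_def by auto
  have "adjunction C D F G \<eta> e"
    unfolding adjunction_def
  proof (intro conjI ballI F G_additive)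
    show "nat_trans D D (F \<circ>\<^sub>F G) id_functor e"
      unfolding nat_trans_def using e G(2) by (simp add: G_Ob)
    show "nat_trans C C id_functor (G \<circ>\<^sub>F F) \<eta>"
      unfolding nat_trans_def
    proof (intro conjI ballI)
      fix x y f assume x: "x \<in> Ob C" and y: "y \<in> Ob C" and f: "f \<in> Hom C x y"
      note Ff = C.functor_Hom[OF F f]
      note Fx = C.functor_Ob[OF F x] and Fy = C.functor_Ob[OF F y]
      show "\<eta> y \<odot>\<^bsub>C\<^esub> farr id_functor f = farr (G \<circ>\<^sub>F F) f \<odot>\<^bsub>C\<^esub> \<eta> x"
        unfolding farr_id farr_comp
      proof (rule cancel[OF C.Comp_closed[OF f \<eta>(1)[OF y]] C.Comp_closed[OF \<eta>(1)[OF x] G(1)[OF Ff]] Fy])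
        have "e (fob F y) \<odot>\<^bsub>D\<^esub> farr F (\<eta> y \<odot>\<^bsub>C\<^esub> f) = farr F f"
          using F_Comp[OF f \<eta>(1)[OF y] Fy] \<eta>(2)[OF y] D.Id_Comp[OF Ff] by simp
        moreover have "e (fob F y) \<odot>\<^bsub>D\<^esub> farr F (farr G (farr F f) \<odot>\<^bsub>C\<^esub> \<eta> x) = farr F f"
          using F_Comp[OF \<eta>(1)[OF x] G(1)[OF Ff] Fy] G(2)[OF Ff] \<eta>(2)[OF x] D.Comp_Id[OF Ff]
            D.Comp_assoc[OF C.functor_Hom[OF F \<eta>(1)[OF x]] e[OF Fx] Ff] by simp
        ultimately show "e (fob F y) \<odot>\<^bsub>D\<^esub> farr F (\<eta> y \<odot>\<^bsub>C\<^esub> f) =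
            e (fob F y) \<odot>\<^bsub>D\<^esub> farr F (farr G (farr F f) \<odot>\<^bsub>C\<^esub> \<eta> x)" by simp
      qed
    qed (simp add: G_Ob \<eta>)
  next
    fix x assume "x \<in> Ob C"
    then show "e (fob F x) \<odot>\<^bsub>D\<^esub> farr F (\<eta> x) = Id D (fob F x)" using \<eta>(2) by simp
  next
    fix y assume y: "y \<in> Ob D"
    note ry = r[OF y]
    note Fr = C.functor_Ob[OF F ry]
    show "farr G (e y) \<odot>\<^bsub>C\<^esub> \<eta> (fob G y) = Id C (fob G y)"
      unfolding G_Ob
    proof (rule cancel[OF C.Comp_closed[OF \<eta>(1)[OF ry] G(1)[OF e[OF y]]] C.Id_closed[OF ry] y])
      show "e y \<odot>\<^bsub>D\<^esub> farr F (farr G (e y) \<odot>\<^bsub>C\<^esub> \<eta> (r y)) = e y \<odot>\<^bsub>D\<^esub> farr F (Id C (r y))"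
        using F_Comp[OF \<eta>(1)[OF ry] G(1)[OF e[OF y]] y] G(2)[OF e[OF y]] \<eta>(2)[OF ry]
          D.Comp_assoc[OF C.functor_Hom[OF F \<eta>(1)[OF ry]] e[OF Fr] e[OF y]] C.functor_Id[OF F ry] by simp
    qed
  qed
  then show ?thesis by blast
qed

text \<open>
  If \<open>N\<close> identifies morphisms \<open>X \<rightarrow> W\<close> with morphisms \<open>N X \<rightarrow> N W\<close> for all \<open>X\<close>, then \<open>W\<close> carries a universal
  arrow to \<open>N W\<close>. Universal arrows pass to kernels: a morphism \<open>N X \<rightarrow> Ker (N v)\<close> is a morphism
  \<open>g : X \<rightarrow> W\<close> with \<open>N (v \<circ> g) = 0\<close>, which by injectivity on morphisms \<open>X \<rightarrow> W'\<close> means \<open>v \<circ> g = 0\<close>,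
  that is, a morphism \<open>X \<rightarrow> Ker v\<close>. The universal arrow \<open>e\<close> is the canonical
  comparison \<open>N (Ker v) \<rightarrow> Ker (N v)\<close>.
\<close>

lemma universal_arrow_from_kernel:
  assumes "abelian_category A" "preadditive_category B" and N: "additive_functor A B N"
    and v: "v \<in> Hom A W W'" and i: "is_kernel B i (farr N v)"
    and bij: "\<And>X. X \<in> Ob A \<Longrightarrow> bij_betw (farr N) (Hom A X W) (Hom B (fob N X) (fob N W))"
    and inj: "\<And>X. X \<in> Ob A \<Longrightarrow> inj_on (farr N) (Hom A X W')"
  shows "\<exists>Z\<in>Ob A. \<exists>e\<in>Hom B (fob N Z) (Dom B i).
    \<forall>X\<in>Ob A. \<forall>h\<in>Hom B (fob N X) (Dom B i). \<exists>!g. g \<in> Hom A X Z \<and> e \<odot>\<^bsub>B\<^esub> farr N g = h"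
proof -
  interpret A: abelian_category A by fact
  interpret B: preadditive_category B by fact
  note N_Hom = A.functor_Hom[OF N] and N_Comp = A.functor_Comp[OF N]
  note N_Zero = functor_Zero[OF A.preadditive_category_axioms B.preadditive_category_axioms N]
  note WW' = A.HomD(1,2)[OF v] and Nv = N_Hom[OF v]
  note i_Hom = B.kernelD(1)[OF i Nv] and i_mono = B.kernel_is_mono[OF i]
  obtain k where k: "is_kernel A k v"
    using A.kernel_exists A.HomD(3)[OF v] by blast
  note k_Hom = A.kernelD(1)[OF k v] and k_mono = A.kernel_is_mono[OF k]
  let ?Z = "Dom A k"
  note Z = A.HomD(1)[OF k_Hom] and Nk = N_Hom[OF k_Hom]
  have "farr N v \<odot>\<^bsub>B\<^esub> farr N k = Zero B (fob N ?Z) (fob N W')"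
    using N_Comp[OF k_Hom v] A.kernelD(2)[OF k v] N_Zero[OF Z WW'(2)] by simp
  then obtain e where e: "e \<in> Hom B (fob N ?Z) (Dom B i)" and ie: "i \<odot>\<^bsub>B\<^esub> e = farr N k"
    using B.kernelD(3)[OF i Nv Nk] by blast
  have "\<exists>!g. g \<in> Hom A X ?Z \<and> e \<odot>\<^bsub>B\<^esub> farr N g = h"
    if X: "X \<in> Ob A" and h: "h \<in> Hom B (fob N X) (Dom B i)" for X h
  proof (rule ex_ex1I)
    have ie_N: "i \<odot>\<^bsub>B\<^esub> (e \<odot>\<^bsub>B\<^esub> farr N g) = farr N (k \<odot>\<^bsub>A\<^esub> g)" if "g \<in> Hom A X ?Z" for g
      using B.Comp_assoc[OF N_Hom[OF that] e i_Hom] ie N_Comp[OF that k_Hom] by simp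
    note ih = B.Comp_closed[OF h i_Hom]
    obtain g where g: "g \<in> Hom A X W" and Ng: "farr N g = i \<odot>\<^bsub>B\<^esub> h"
      using bij[OF X] ih unfolding bij_betw_def by (metis imageE)
    have "farr N (v \<odot>\<^bsub>A\<^esub> g) = farr N v \<odot>\<^bsub>B\<^esub> (i \<odot>\<^bsub>B\<^esub> h)"
      using N_Comp[OF g v] Ng by simp
    also have "\<dots> = Zero B (Dom B i) (fob N W') \<odot>\<^bsub>B\<^esub> h"
      using B.Comp_assoc[OF h i_Hom Nv] B.kernelD(2)[OF i Nv] by simp
    also have "\<dots> = farr N (Zero A X W')"
      using B.Zero_Comp[OF h B.HomD(2)[OF Nv]] N_Zero[OF X WW'(2)] by simp
    finally have "v \<odot>\<^bsub>A\<^esub> g = Zero A X W'"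
      using inj_onD[OF inj[OF X]] A.Comp_closed[OF g v] A.Zero_closed[OF X WW'(2)] by blast
    then obtain g' where g': "g' \<in> Hom A X ?Z" "k \<odot>\<^bsub>A\<^esub> g' = g"
      using A.kernelD(3)[OF k v g] by blast
    have "i \<odot>\<^bsub>B\<^esub> (e \<odot>\<^bsub>B\<^esub> farr N g') = i \<odot>\<^bsub>B\<^esub> h"
      using ie_N[OF g'(1)] g'(2) Ng by simp
    then have "e \<odot>\<^bsub>B\<^esub> farr N g' = h"
      using B.monoD[OF i_mono i_Hom B.Comp_closed[OF N_Hom[OF g'(1)] e] h] by blast
    then show "\<exists>g. g \<in> Hom A X ?Z \<and> e \<odot>\<^bsub>B\<^esub> farr N g = h"
      using g'(1) by blast
  next
    fix g g' assume "g \<in> Hom A X ?Z \<and> e \<odot>\<^bsub>B\<^esub> farr N g = h" "g' \<in> Hom A X ?Z \<and> e \<odot>\<^bsub>B\<^esub> farr N g' = h"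
    then have g: "g \<in> Hom A X ?Z" and g': "g' \<in> Hom A X ?Z"
      and eq: "e \<odot>\<^bsub>B\<^esub> farr N g = e \<odot>\<^bsub>B\<^esub> farr N g'" by auto
    have "farr N (k \<odot>\<^bsub>A\<^esub> g) = farr N (k \<odot>\<^bsub>A\<^esub> g')"
      using eq ie N_Comp[OF g k_Hom] N_Comp[OF g' k_Hom]
        B.Comp_assoc[OF N_Hom[OF g] e i_Hom] B.Comp_assoc[OF N_Hom[OF g'] e i_Hom] by simp
    then have "k \<odot>\<^bsub>A\<^esub> g = k \<odot>\<^bsub>A\<^esub> g'"
      using bij[OF X] A.Comp_closed[OF g k_Hom] A.Comp_closed[OF g' k_Hom]
      by (meson bij_betw_def inj_onD)
    then show "g = g'"
      by (rule A.monoD[OF k_mono k_Hom g g'])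
  qed
  then show ?thesis
    using Z e by blast
qed

text \<open>
  Both \<open>W\<close> and \<open>M (N W)\<close> represent the functor \<open>X \<mapsto> Hom (N X) (N W)\<close>. The inverse of \<open>\<eta> W\<close> is the morphism
  \<open>g : M (N W) \<rightarrow> W\<close> that \<open>N\<close> sends to the counit at \<open>N W\<close>.
\<close>

lemma unit_is_iso:
  assumes "category A" "category B" and adj: "adjunction A B N M \<eta> \<epsilon>" and W: "W \<in> Ob A"
    and bij: "\<And>X. X \<in> Ob A \<Longrightarrow> bij_betw (farr N) (Hom A X W) (Hom B (fob N X) (fob N W))"
  shows "is_iso A (\<eta> W)"
proof -
  interpret A: category A by fact
  interpret B: category B by fact
  note N = adjunctionD(1)[OF adj] and M = adjunctionD(2)[OF adj]
  let ?V = "fob M (fob N W)"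
  have NW: "fob N W \<in> Ob B" using A.functor_Ob[OF N W] .
  have V: "?V \<in> Ob A" using B.functor_Ob[OF M NW] .
  have \<eta>W: "\<eta> W \<in> Hom A W ?V"
    using A.nat_trans_Hom[OF adjunctionD(3)[OF adj] W] by simp
  have \<epsilon>: "\<epsilon> (fob N W) \<in> Hom B (fob N ?V) (fob N W)"
    using B.nat_trans_Hom[OF adjunctionD(4)[OF adj] NW] by simp
  obtain g where g: "g \<in> Hom A ?V W" and Ng: "farr N g = \<epsilon> (fob N W)"
    using bij[OF V] \<epsilon> unfolding bij_betw_def by (metis imageE)
  have "farr N (g \<odot>\<^bsub>A\<^esub> \<eta> W) = farr N (Id A W)"
    using A.functor_Comp[OF N \<eta>W g] Ng adjunctionD(5)[OF adj W] A.functor_Id[OF N W] by simp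
  then have 1: "g \<odot>\<^bsub>A\<^esub> \<eta> W = Id A W"
    using bij[OF W] A.Comp_closed[OF \<eta>W g] A.Id_closed[OF W] by (meson bij_betw_def inj_onD)
  have "\<eta> W \<odot>\<^bsub>A\<^esub> g = farr M (farr N g) \<odot>\<^bsub>A\<^esub> \<eta> ?V"
    using A.nat_trans_natural[OF adjunctionD(3)[OF adj] g] by simp
  also have "\<dots> = Id A ?V"
    using Ng adjunctionD(6)[OF adj NW] by simp
  finally show ?thesis
    using 1 g \<eta>W A.HomD[OF \<eta>W] unfolding is_iso_def by auto
qed

section \<open>Adjunctions with a faithful right adjoint\<close>

locale faithful_adjunction = A: abelian_category A + D: category D
  for A :: "('a, 'm) precat" (structure) and D :: "('d, 'n) precat" +
  fixes L :: "('d, 'n, 'a, 'm) cfunctor" and U :: "('a, 'm, 'd, 'n) cfunctor"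
    and \<eta> :: "'d \<Rightarrow> 'n" and \<epsilon> :: "'a \<Rightarrow> 'm"
  assumes adj: "adjunction D A L U \<eta> \<epsilon>" and faithful: "faithful_functor A D U"
begin

lemmas L_additive = adjunctionD(1)[OF adj]
lemmas U_additive = adjunctionD(2)[OF adj]

lemma L_Ob: "d \<in> Ob D \<Longrightarrow> fob L d \<in> Ob A"
  using D.functor_Ob[OF L_additive] .

lemma U_Ob: "X \<in> Ob A \<Longrightarrow> fob U X \<in> Ob D"
  using A.functor_Ob[OF U_additive] .

lemma counit_Hom: "X \<in> Ob A \<Longrightarrow> \<epsilon> X \<in> Hom A (fob L (fob U X)) X"
  using A.nat_trans_Hom[OF adjunctionD(4)[OF adj]] by simp

lemma unit_Hom: "d \<in> Ob D \<Longrightarrow> \<eta> d \<in> Hom D d (fob U (fob L d))"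
  using D.nat_trans_Hom[OF adjunctionD(3)[OF adj]] by simp

text \<open>
  By the triangle identity \<open>U (\<epsilon> X)\<close> has the right inverse \<open>\<eta> (U X)\<close>, so it is an epimorphism, and the
  faithful functor \<open>U\<close> reflects epimorphisms.
\<close>

lemma counit_is_epi:
  assumes X: "X \<in> Ob A"
  shows "is_epi A (\<epsilon> X)"
proof (rule A.epiI[OF counit_Hom[OF X]])
  note UX = U_Ob[OF X] and \<epsilon>X = counit_Hom[OF X]
  have U_recover: "farr U g = farr U (g \<odot> \<epsilon> X) \<odot>\<^bsub>D\<^esub> \<eta> (fob U X)" if g: "g \<in> Hom A X Z" for g Z
    using A.functor_Comp[OF U_additive \<epsilon>X g] adjunctionD(6)[OF adj X]
      D.Comp_assoc[OF unit_Hom[OF UX] A.functor_Hom[OF U_additive \<epsilon>X] A.functor_Hom[OF U_additive g]]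
      D.Comp_Id[OF A.functor_Hom[OF U_additive g]] by simp
  fix Z g h assume g: "g \<in> Hom A X Z" and h: "h \<in> Hom A X Z" and "g \<odot> \<epsilon> X = h \<odot> \<epsilon> X"
  then have "farr U g = farr U h"
    using U_recover[OF g] U_recover[OF h] by simp
  then show "g = h"
    using faithful g h X A.HomD(2)[OF g] unfolding faithful_functor_def by (meson inj_onD)
qed

lemma factors_through_counit:
  assumes d: "d \<in> Ob D" and h: "h \<in> Hom A (fob L d) X"
  shows "\<exists>g\<in>Hom D d (fob U X). \<epsilon> X \<odot> farr L g = h"
proof
  note X = A.HomD(2)[OF h]
  have Uh: "farr U h \<in> Hom D (fob U (fob L d)) (fob U X)"
    using A.functor_Hom[OF U_additive h] .
  let ?g = "farr U h \<odot>\<^bsub>D\<^esub> \<eta> d"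
  show "?g \<in> Hom D d (fob U X)"
    using D.Comp_closed[OF unit_Hom[OF d] Uh] .
  note L\<eta> = D.functor_Hom[OF L_additive unit_Hom[OF d]]
  have "\<epsilon> X \<odot> farr L ?g = (\<epsilon> X \<odot> farr L (farr U h)) \<odot> farr L (\<eta> d)"
    using D.functor_Comp[OF L_additive unit_Hom[OF d] Uh]
      A.Comp_assoc[OF L\<eta> D.functor_Hom[OF L_additive Uh] counit_Hom[OF X]] by simp
  also have "\<dots> = (h \<odot> \<epsilon> (fob L d)) \<odot> farr L (\<eta> d)"
    using A.nat_trans_natural[OF adjunctionD(4)[OF adj] h] by simp
  also have "\<dots> = h"
    using A.Comp_assoc[OF L\<eta> counit_Hom[OF L_Ob[OF d]] h] adjunctionD(5)[OF adj d] A.Comp_Id[OF h] by simp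
  finally show "\<epsilon> X \<odot> farr L ?g = h" .
qed

text \<open>
  The counit at \<open>X\<close> is the cokernel of its kernel \<open>k : K \<rightarrow> L (U X)\<close>, and precomposing \<open>k\<close> with the epimorphism
  \<open>\<epsilon> K\<close> does not change its cokernel while it moves the source into the image of \<open>L\<close>.
\<close>

lemma counit_is_cokernel:
  assumes X: "X \<in> Ob A"
  shows "\<exists>d\<in>Ob D. \<exists>a\<in>Hom A (fob L d) (fob L (fob U X)). is_cokernel A (\<epsilon> X) a"
proof -
  note \<epsilon>X = counit_Hom[OF X]
  obtain k where k: "is_kernel A k (\<epsilon> X)"
    using A.kernel_exists A.HomD(3)[OF \<epsilon>X] by blast
  let ?K = "Dom A k"
  note k_Hom = A.kernelD(1)[OF k \<epsilon>X]
  note K = A.HomD(1)[OF k_Hom]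
  note \<epsilon>K = counit_Hom[OF K]
  note d = U_Ob[OF K]
  let ?a = "k \<odot> \<epsilon> ?K"
  note a = A.Comp_closed[OF \<epsilon>K k_Hom]
  have coker: "is_cokernel A (\<epsilon> X) k"
    using A.epi_is_cokernel_of_kernel[OF counit_is_epi[OF X] k] .
  have "\<exists>!u. u \<in> Hom A X Z \<and> u \<odot> \<epsilon> X = h"
    if Z: "Z \<in> Ob A" and h: "h \<in> Hom A (fob L (fob U X)) Z"
      and ha: "h \<odot> ?a = Zero A (fob L (fob U ?K)) Z" for Z h
  proof -
    have "(h \<odot> k) \<odot> \<epsilon> ?K = Zero A ?K Z \<odot> \<epsilon> ?K"
      using ha A.Comp_assoc[OF \<epsilon>K k_Hom h] A.Zero_Comp[OF \<epsilon>K Z] by simp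
    then have "h \<odot> k = Zero A ?K Z"
      by (rule A.epiD[OF counit_is_epi[OF K] \<epsilon>K A.Comp_closed[OF k_Hom h] A.Zero_closed[OF K Z]])
    then show ?thesis
      using coker Z h A.HomD(4,5)[OF \<epsilon>X] A.HomD(5)[OF k_Hom] unfolding is_cokernel_def by simp
  qed
  moreover have "\<epsilon> X \<odot> ?a = Zero A (fob L (fob U ?K)) X"
    using A.Comp_assoc[OF \<epsilon>K k_Hom \<epsilon>X] A.kernelD(2)[OF k \<epsilon>X] A.Zero_Comp[OF \<epsilon>K X] by simp
  ultimately have "is_cokernel A (\<epsilon> X) ?a"
    unfolding is_cokernel_def using A.HomD(3-5)[OF \<epsilon>X] A.HomD(3-5)[OF a] by simp
  with d a show ?thesis by blast
qed

text \<open>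
  A functor that is fully faithful on the image of \<open>L\<close> is so on all morphisms from an arbitrary object into
  that image. Let \<open>\<epsilon> X\<close> be the cokernel of \<open>a\<close>. Given \<open>h : N X \<rightarrow> N (L d)\<close>, lift \<open>h \<circ> N (\<epsilon> X)\<close> to
  \<open>g : L (U X) \<rightarrow> L d\<close>; then \<open>N (g \<circ> a) = 0\<close>, so \<open>g \<circ> a = 0\<close> and \<open>g\<close> descends to \<open>X\<close>. As \<open>N (\<epsilon> X)\<close> is an
  epimorphism, \<open>h\<close> is the image of the descended morphism.
\<close>

lemma bij_betw_maps_into_image:
  assumes "preadditive_category B" and N: "additive_functor A B N"
    and N_epi: "\<And>p. is_epi A p \<Longrightarrow> is_epi B (farr N p)"
    and ff: "\<And>c d. c \<in> Ob D \<Longrightarrow> d \<in> Ob D \<Longrightarrow>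
      bij_betw (farr N) (Hom A (fob L c) (fob L d)) (Hom B (fob N (fob L c)) (fob N (fob L d)))"
    and X: "X \<in> Ob A" and d: "d \<in> Ob D"
  shows "bij_betw (farr N) (Hom A X (fob L d)) (Hom B (fob N X) (fob N (fob L d)))"
proof -
  interpret B: preadditive_category B by fact
  note N_Hom = A.functor_Hom[OF N] and N_Comp = A.functor_Comp[OF N]
  note N_Zero = functor_Zero[OF A.preadditive_category_axioms B.preadditive_category_axioms N]
  note Ld = L_Ob[OF d] and \<epsilon>X = counit_Hom[OF X]
  note N\<epsilon> = N_Hom[OF \<epsilon>X] and N\<epsilon>_epi = N_epi[OF counit_is_epi[OF X]]
  have ff_inj: "inj_on (farr N) (Hom A (fob L c) (fob L d))" if "c \<in> Ob D" for c
    using ff[OF that d] bij_betw_def by blast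
  have "inj_on (farr N) (Hom A X (fob L d))"
  proof (rule inj_onI)
    fix g h assume g: "g \<in> Hom A X (fob L d)" and h: "h \<in> Hom A X (fob L d)"
      and "farr N g = farr N h"
    then have "farr N (g \<odot> \<epsilon> X) = farr N (h \<odot> \<epsilon> X)"
      using N_Comp[OF \<epsilon>X g] N_Comp[OF \<epsilon>X h] by simp
    then have "g \<odot> \<epsilon> X = h \<odot> \<epsilon> X"
      using inj_onD[OF ff_inj[OF U_Ob[OF X]]] A.Comp_closed[OF \<epsilon>X g] A.Comp_closed[OF \<epsilon>X h] by blast
    then show "g = h"
      by (rule A.epiD[OF counit_is_epi[OF X] \<epsilon>X g h])
  qed
  moreover have "farr N ` Hom A X (fob L d) = Hom B (fob N X) (fob N (fob L d))"
  proof (intro equalityI subsetI)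
    fix h assume h: "h \<in> Hom B (fob N X) (fob N (fob L d))"
    obtain g where g: "g \<in> Hom A (fob L (fob U X)) (fob L d)" and Ng: "farr N g = h \<odot>\<^bsub>B\<^esub> farr N (\<epsilon> X)"
      using ff[OF U_Ob[OF X] d] B.Comp_closed[OF N\<epsilon> h] unfolding bij_betw_def by (metis imageE)
    obtain c a where c: "c \<in> Ob D" and a: "a \<in> Hom A (fob L c) (fob L (fob U X))"
      and coker: "is_cokernel A (\<epsilon> X) a"
      using counit_is_cokernel[OF X] by blast
    note Lc = L_Ob[OF c]
    have \<epsilon>a: "\<epsilon> X \<odot> a = Zero A (fob L c) X"
      using coker A.HomD(4)[OF a] A.HomD(5)[OF \<epsilon>X] unfolding is_cokernel_def by simp
    have "farr N (g \<odot> a) = h \<odot>\<^bsub>B\<^esub> farr N (\<epsilon> X \<odot> a)"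
      using N_Comp[OF a g] N_Comp[OF a \<epsilon>X] Ng B.Comp_assoc[OF N_Hom[OF a] N\<epsilon> h] by simp
    also have "\<dots> = farr N (Zero A (fob L c) (fob L d))"
      using \<epsilon>a N_Zero[OF Lc X] N_Zero[OF Lc Ld] B.Comp_Zero[OF h A.functor_Ob[OF N Lc]] by simp
    finally have "g \<odot> a = Zero A (fob L c) (fob L d)"
      using inj_onD[OF ff_inj[OF c]] A.Comp_closed[OF a g] A.Zero_closed[OF Lc Ld] by blast
    then have "\<exists>!u. u \<in> Hom A X (fob L d) \<and> u \<odot> \<epsilon> X = g"
      using coker g Ld A.HomD(4,5)[OF a] A.HomD(5)[OF \<epsilon>X] unfolding is_cokernel_def by simp
    then obtain u where u: "u \<in> Hom A X (fob L d)" "u \<odot> \<epsilon> X = g" by blast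
    have "farr N u \<odot>\<^bsub>B\<^esub> farr N (\<epsilon> X) = h \<odot>\<^bsub>B\<^esub> farr N (\<epsilon> X)"
      using N_Comp[OF \<epsilon>X u(1)] u(2) Ng by simp
    then have "farr N u = h"
      by (rule B.epiD[OF N\<epsilon>_epi N\<epsilon> N_Hom[OF u(1)] h])
    then show "h \<in> farr N ` Hom A X (fob L d)"
      using u(1) by blast
  qed (use N_Hom in auto)
  ultimately show ?thesis
    unfolding bij_betw_def by blast
qed

text \<open>
  The next three lemmas concern natural transformations \<open>\<tau> : 1 \<rightarrow> T\<close> that are the identity on the image
  of \<open>L\<close>. Naturality at \<open>\<epsilon> X\<close> forces the value of \<open>\<tau> X \<circ> \<epsilon> X\<close>, which determines \<open>\<tau> X\<close>.
\<close>

lemma nat_trans_from_id_counit: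
  assumes "nat_trans A A id_functor T \<tau>" and "\<And>d. d \<in> Ob D \<Longrightarrow> \<tau> (fob L d) = Id A (fob L d)"
    and T: "additive_functor A A T" and T_Ob: "\<And>d. d \<in> Ob D \<Longrightarrow> fob T (fob L d) = fob L d"
    and X: "X \<in> Ob A"
  shows "\<tau> X \<odot> \<epsilon> X = farr T (\<epsilon> X)"
  using A.nat_trans_natural[OF assms(1) counit_Hom[OF X]] assms(2)[OF U_Ob[OF X]]
    A.functor_Hom[OF T counit_Hom[OF X]] T_Ob[OF U_Ob[OF X]] A.Comp_Id[of "farr T (\<epsilon> X)"] by simp

lemma nat_trans_from_id_unique:
  assumes T: "additive_functor A A T" and T_Ob: "\<And>d. d \<in> Ob D \<Longrightarrow> fob T (fob L d) = fob L d"
    and \<tau>: "nat_trans A A id_functor T \<tau>" "\<And>d. d \<in> Ob D \<Longrightarrow> \<tau> (fob L d) = Id A (fob L d)"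
    and \<tau>': "nat_trans A A id_functor T \<tau>'" "\<And>d. d \<in> Ob D \<Longrightarrow> \<tau>' (fob L d) = Id A (fob L d)"
    and X: "X \<in> Ob A"
  shows "\<tau> X = \<tau>' X"
proof (rule A.epiD[OF counit_is_epi[OF X] counit_Hom[OF X]])
  show "\<tau> X \<in> Hom A X (fob T X)" "\<tau>' X \<in> Hom A X (fob T X)"
    using A.nat_trans_Hom[OF \<tau>(1) X] A.nat_trans_Hom[OF \<tau>'(1) X] by simp_all
  show "\<tau> X \<odot> \<epsilon> X = \<tau>' X \<odot> \<epsilon> X"
    using nat_trans_from_id_counit[OF \<tau> T T_Ob X] nat_trans_from_id_counit[OF \<tau>' T T_Ob X] by simp
qed

text \<open>
  If \<open>\<epsilon> X\<close> is the cokernel of \<open>a\<close>, then \<open>T a = a\<close> gives \<open>T (\<epsilon> X) \<circ> a = T (\<epsilon> X \<circ> a) = 0\<close>, so \<open>T (\<epsilon> X)\<close> descends to a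
  morphism \<open>\<tau> X : X \<rightarrow> T X\<close>. Every \<open>h : L d \<rightarrow> X\<close> factors through \<open>\<epsilon> X\<close>, hence \<open>\<tau> X \<circ> h = T h\<close>.
  Naturality is the case \<open>h = f \<circ> \<epsilon> X\<close>, and normalisation on the image of \<open>L\<close> is the case \<open>h = 1\<close>.
\<close>

lemma nat_trans_from_id_exists:
  assumes T: "additive_functor A A T" and T_Ob: "\<And>d. d \<in> Ob D \<Longrightarrow> fob T (fob L d) = fob L d"
    and T_Hom: "\<And>c d g. c \<in> Ob D \<Longrightarrow> d \<in> Ob D \<Longrightarrow> g \<in> Hom A (fob L c) (fob L d) \<Longrightarrow> farr T g = g"
  shows "\<exists>\<tau>. nat_trans A A id_functor T \<tau> \<and> (\<forall>d\<in>Ob D. \<tau> (fob L d) = Id A (fob L d))"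
proof -
  have "\<exists>t\<in>Hom A X (fob T X). t \<odot> \<epsilon> X = farr T (\<epsilon> X)" if X: "X \<in> Ob A" for X
  proof -
    note \<epsilon>X = counit_Hom[OF X] and UX = U_Ob[OF X] and TX = A.functor_Ob[OF T X]
    have T\<epsilon>: "farr T (\<epsilon> X) \<in> Hom A (fob L (fob U X)) (fob T X)"
      using A.functor_Hom[OF T \<epsilon>X] T_Ob[OF UX] by simp
    obtain c a where c: "c \<in> Ob D" and a: "a \<in> Hom A (fob L c) (fob L (fob U X))"
      and coker: "is_cokernel A (\<epsilon> X) a"
      using counit_is_cokernel[OF X] by blast
    note Lc = L_Ob[OF c]
    have \<epsilon>a: "\<epsilon> X \<odot> a = Zero A (fob L c) X"
      using coker A.HomD(4)[OF a] A.HomD(5)[OF \<epsilon>X] unfolding is_cokernel_def by simp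
    have "farr T (\<epsilon> X) \<odot> a = farr T (\<epsilon> X \<odot> a)"
      using A.functor_Comp[OF T a \<epsilon>X] T_Hom[OF c UX a] by simp
    also have "\<dots> = Zero A (fob L c) (fob T X)"
      using \<epsilon>a functor_Zero[OF A.preadditive_category_axioms A.preadditive_category_axioms T Lc X]
        T_Ob[OF c] by simp
    finally have "\<exists>!u. u \<in> Hom A X (fob T X) \<and> u \<odot> \<epsilon> X = farr T (\<epsilon> X)"
      using coker T\<epsilon> TX A.HomD(4,5)[OF a] A.HomD(5)[OF \<epsilon>X] unfolding is_cokernel_def by simp
    then show ?thesis by blast
  qed
  then obtain \<tau> where \<tau>: "\<And>X. X \<in> Ob A \<Longrightarrow> \<tau> X \<in> Hom A X (fob T X)"
    and \<tau>_counit: "\<And>X. X \<in> Ob A \<Longrightarrow> \<tau> X \<odot> \<epsilon> X = farr T (\<epsilon> X)"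
    by metis
  have \<tau>_Comp: "\<tau> X \<odot> h = farr T h" if d: "d \<in> Ob D" and h: "h \<in> Hom A (fob L d) X" for d h X
  proof -
    note X = A.HomD(2)[OF h]
    obtain g where g: "g \<in> Hom D d (fob U X)" and h_eq: "\<epsilon> X \<odot> farr L g = h"
      using factors_through_counit[OF d h] by blast
    note Lg = D.functor_Hom[OF L_additive g]
    have "\<tau> X \<odot> h = farr T (\<epsilon> X) \<odot> farr L g"
      using A.Comp_assoc[OF Lg counit_Hom[OF X] \<tau>[OF X]] h_eq \<tau>_counit[OF X] by simp
    also have "\<dots> = farr T h"
      using A.functor_Comp[OF T Lg counit_Hom[OF X]] T_Hom[OF d U_Ob[OF X] Lg] h_eq by simp
    finally show ?thesis .
  qed
  have "nat_trans A A id_functor T \<tau>"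
    unfolding nat_trans_def fob_id farr_id
  proof (intro conjI ballI)
    fix X Y f assume X: "X \<in> Ob A" and Y: "Y \<in> Ob A" and f: "f \<in> Hom A X Y"
    note \<epsilon>X = counit_Hom[OF X] and Tf = A.functor_Hom[OF T f]
    have "(\<tau> Y \<odot> f) \<odot> \<epsilon> X = farr T (f \<odot> \<epsilon> X)"
      using A.Comp_assoc[OF \<epsilon>X f \<tau>[OF Y]] \<tau>_Comp[OF U_Ob[OF X] A.Comp_closed[OF \<epsilon>X f]] by simp
    also have "\<dots> = (farr T f \<odot> \<tau> X) \<odot> \<epsilon> X"
      using A.Comp_assoc[OF \<epsilon>X \<tau>[OF X] Tf] A.functor_Comp[OF T \<epsilon>X f] \<tau>_counit[OF X] by simp
    finally show "\<tau> Y \<odot> f = farr T f \<odot> \<tau> X"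
      by (rule A.epiD[OF counit_is_epi[OF X] \<epsilon>X A.Comp_closed[OF f \<tau>[OF Y]] A.Comp_closed[OF \<tau>[OF X] Tf]])
  qed (use \<tau> in auto)
  moreover have "\<tau> (fob L d) = Id A (fob L d)" if d: "d \<in> Ob D" for d
  proof -
    note Ld = L_Ob[OF d]
    have "\<tau> (fob L d) \<odot> Id A (fob L d) = Id A (fob L d)"
      using \<tau>_Comp[OF d A.Id_closed[OF Ld]] T_Hom[OF d d A.Id_closed[OF Ld]] by simp
    then show ?thesis
      using A.Comp_Id[OF \<tau>[OF Ld]] by simp
  qed
  ultimately show ?thesis by blast
qed

end

text \<open>
  Here \<open>U\<close> is the left adjoint of \<open>R\<close>. In the opposite categories it becomes the right adjoint, and the
  unit of \<open>U \<stileturn> R\<close> becomes the counit, so that all results on counits apply to it.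
\<close>

lemma faithful_adjunction_op:
  assumes "abelian_category A" "category D" "adjunction A D U R \<eta> \<epsilon>" "faithful_functor A D U"
  shows "faithful_adjunction (op_cat A) (op_cat D) R U \<epsilon> \<eta>"
  using assms
  by (simp add: faithful_adjunction_def faithful_adjunction_axioms_def abelian_category_op
      category_op adjunction_op faithful_functor_op)

section \<open>Nakayama functors\<close>

lemma inverse_functorsD:
  assumes "inverse_functors C D F G"
  shows "f \<in> Mor C \<Longrightarrow> farr G (farr F f) = f" and "g \<in> Mor D \<Longrightarrow> farr F (farr G g) = g"
proof -
  have eq: "functor_eq C (G \<circ>\<^sub>F F) id_functor" "functor_eq D (F \<circ>\<^sub>F G) id_functor"
    using assms unfolding inverse_functors_def by blast+
  show "farr G (farr F f) = f" if "f \<in> Mor C"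
    using bspec[OF conjunct2[OF eq(1)[unfolded functor_eq_def]] that] by simp
  show "farr F (farr G g) = g" if "g \<in> Mor D"
    using bspec[OF conjunct2[OF eq(2)[unfolded functor_eq_def]] that] by simp
qed

lemma im_restrict_inverseD:
  assumes inv: "inverse_functors (im_cat D A F) (im_cat D A G) (im_restrict N) (im_restrict M)"
    and d: "c \<in> Ob D" "d \<in> Ob D"
  shows "g \<in> Hom A (fob F c) (fob F d) \<Longrightarrow> farr M (farr N g) = g"
    and "h \<in> Hom A (fob G c) (fob G d) \<Longrightarrow> farr N (farr M h) = h"
proof -
  show "farr M (farr N g) = g" if "g \<in> Hom A (fob F c) (fob F d)"
  proof -
    have "(c, g, d) \<in> Mor (im_cat D A F)"
      using d that by (simp add: im_cat_def)
    from inverse_functorsD(1)[OF inv this] show ?thesis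
      by (simp add: im_restrict_def)
  qed
  show "farr N (farr M h) = h" if "h \<in> Hom A (fob G c) (fob G d)"
  proof -
    have "(c, h, d) \<in> Mor (im_cat D A G)"
      using d that by (simp add: im_cat_def)
    from inverse_functorsD(2)[OF inv this] show ?thesis
      by (simp add: im_restrict_def)
  qed
qed

text \<open>
  The inverse \<open>H\<close> is an arbitrary functor between the image categories. Since \<open>im_restrict N\<close> preserves the
  end points recorded in a triple, \<open>H\<close> must do so too, and it lifts each morphism of \<open>im G\<close> to a
  morphism of \<open>im F\<close> with the same end points.
\<close>

lemma im_restrict_iso_bij_betw:
  fixes D :: "('a, 'b) precat" and A :: "('c, 'd) precat" and F G :: "('a, 'b, 'c, 'd) cfunctor"
  assumes iso: "category_isomorphism (im_cat D A F) (im_cat D A G) (im_restrict N)"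
    and d: "c \<in> Ob D" "d \<in> Ob D"
  shows "bij_betw (farr N) (Hom A (fob F c) (fob F d)) (Hom A (fob G c) (fob G d))"
proof -
  have in_im: "(x, g, y) \<in> Hom (im_cat D A F) x y \<longleftrightarrow> x \<in> Ob D \<and> y \<in> Ob D \<and> g \<in> Hom A (fob F x) (fob F y)"
    for x g y and F :: "('a, 'b, 'c, 'd) cfunctor" by (simp add: im_cat_def Hom_def)
  have im_Ob: "Ob (im_cat D A F) = Ob D" for F :: "('a, 'b, 'c, 'd) cfunctor"
    by (simp add: im_cat_def)
  obtain H where inv: "inverse_functors (im_cat D A F) (im_cat D A G) (im_restrict N) H"
    using iso unfolding category_isomorphism_def by blast
  have HN: "farr H (x, farr N g, y) = (x, g, y)"
    if "x \<in> Ob D" "y \<in> Ob D" "g \<in> Hom A (fob F x) (fob F y)" for x y g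
  proof -
    have "(x, g, y) \<in> Mor (im_cat D A F)"
      using that by (simp add: im_cat_def)
    from inverse_functorsD(1)[OF inv this] show ?thesis
      by (simp add: im_restrict_def)
  qed
  show ?thesis
  proof (intro bij_betw_imageI inj_onI equalityI subsetI)
    fix g h assume g: "g \<in> Hom A (fob F c) (fob F d)" and h: "h \<in> Hom A (fob F c) (fob F d)"
      and eq: "farr N g = farr N h"
    have "(c, g, d) = (c, h, d)"
      using HN[OF d g] HN[OF d h] unfolding eq by (rule trans[OF sym])
    then show "g = h"
      by simp
  next
    fix k assume "k \<in> farr N ` Hom A (fob F c) (fob F d)"
    then obtain g where g: "g \<in> Hom A (fob F c) (fob F d)" and k: "k = farr N g" by blast
    have additive: "additive_functor (im_cat D A F) (im_cat D A G) (im_restrict N)"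
      using inv unfolding inverse_functors_def by blast
    have "(c, g, d) \<in> Hom (im_cat D A F) c d"
      using d g in_im by blast
    then have "farr (im_restrict N) (c, g, d) \<in>
        Hom (im_cat D A G) (fob (im_restrict N) c) (fob (im_restrict N) d)"
      using additive d by (simp add: additive_functor_def im_Ob)
    then have "(c, k, d) \<in> Hom (im_cat D A G) c d"
      by (simp add: im_restrict_def k)
    then show "k \<in> Hom A (fob G c) (fob G d)"
      using in_im by blast
  next
    fix k assume k: "k \<in> Hom A (fob G c) (fob G d)"
    have additive: "additive_functor (im_cat D A G) (im_cat D A F) H"
      using inv unfolding inverse_functors_def by blast
    have "(c, k, d) \<in> Hom (im_cat D A G) c d"
      using d k in_im by blast
    then have "farr H (c, k, d) \<in> Hom (im_cat D A F) (fob H c) (fob H d)"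
      using additive d by (simp add: additive_functor_def im_Ob)
    then have "farr H (c, k, d) \<in> Mor (im_cat D A F)"
      unfolding Hom_def by blast
    then obtain x g y where H: "farr H (c, k, d) = (x, g, y)"
      and g: "g \<in> Hom A (fob F x) (fob F y)"
      by (auto simp: im_cat_def)
    have "(c, k, d) \<in> Mor (im_cat D A G)"
      using d k by (simp add: im_cat_def)
    then have "farr (im_restrict N) (farr H (c, k, d)) = (c, k, d)"
      by (rule inverse_functorsD(2)[OF inv])
    then have "x = c" "farr N g = k" "y = d"
      using H by (simp_all add: im_restrict_def)
    then show "k \<in> farr N ` Hom A (fob F c) (fob F d)"
      using g by blast
  qed
qed

lemma is_left_adjoint_cong_right:
  assumes "preadditive_category C" "preadditive_category D"
    and eq: "functor_eq D G G'" and "is_left_adjoint C D F G"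
  shows "is_left_adjoint C D F G'"
proof -
  interpret C: preadditive_category C by fact
  interpret D: preadditive_category D by fact
  obtain \<eta> \<epsilon> where adj: "adjunction C D F G \<eta> \<epsilon>"
    using assms(4) unfolding is_left_adjoint_def by blast
  note F = adjunctionD(1)[OF adj] and \<eta> = adjunctionD(3)[OF adj] and \<epsilon> = adjunctionD(4)[OF adj]
  note ob = functor_eqD(1)[OF eq] and arr = functor_eqD(2)[OF eq]
  have "adjunction C D F G' \<eta> \<epsilon>"
    unfolding adjunction_def
  proof (intro conjI ballI F)
    show "additive_functor D C G'"
      using additive_functor_cong[OF eq D.preadditive_category_axioms adjunctionD(2)[OF adj]] .
    show "nat_trans C C id_functor (G' \<circ>\<^sub>F F) \<eta>"
      unfolding nat_trans_def fob_comp farr_comp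
    proof (intro conjI ballI)
      fix x assume x: "x \<in> Ob C"
      show "\<eta> x \<in> Hom C (fob id_functor x) (fob G' (fob F x))"
        using C.nat_trans_Hom[OF \<eta> x] ob[OF C.functor_Ob[OF F x]] by simp
    next
      fix x y f assume f: "f \<in> Hom C x y"
      show "\<eta> y \<odot>\<^bsub>C\<^esub> farr id_functor f = farr G' (farr F f) \<odot>\<^bsub>C\<^esub> \<eta> x"
        using C.nat_trans_natural[OF \<eta> f] arr[OF C.functor_Hom[OF F f]] by simp
    qed
    show "nat_trans D D (F \<circ>\<^sub>F G') id_functor \<epsilon>"
      unfolding nat_trans_def fob_comp farr_comp
    proof (intro conjI ballI)
      fix x assume x: "x \<in> Ob D"
      show "\<epsilon> x \<in> Hom D (fob F (fob G' x)) (fob id_functor x)"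
        using D.nat_trans_Hom[OF \<epsilon> x] ob[OF x] by simp
    next
      fix x y f assume f: "f \<in> Hom D x y"
      show "\<epsilon> y \<odot>\<^bsub>D\<^esub> farr F (farr G' f) = farr id_functor f \<odot>\<^bsub>D\<^esub> \<epsilon> x"
        using D.nat_trans_natural[OF \<epsilon> f] arr[OF f] by simp
    qed
    show "\<epsilon> (fob F x) \<odot>\<^bsub>D\<^esub> farr F (\<eta> x) = Id D (fob F x)" if "x \<in> Ob C" for x
      using adjunctionD(5)[OF adj that] .
    show "farr G' (\<epsilon> y) \<odot>\<^bsub>C\<^esub> \<eta> (fob G' y) = Id C (fob G' y)" if y: "y \<in> Ob D" for y
      using adjunctionD(6)[OF adj y] arr[OF D.nat_trans_Hom[OF \<epsilon> y]] ob[OF y] by simp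
  qed
  then show ?thesis
    unfolding is_left_adjoint_def by blast
qed

text \<open>
  A right adjoint is chosen through universal arrows. Its unit at \<open>L d\<close> need not be an identity, but it is
  invertible, since \<open>L d\<close> itself carries a universal arrow to \<open>N (L d)\<close>.
\<close>

lemma nakayama_functor_of_iso_on_image:
  assumes A: "abelian_category A" and D: "additive_category D"
    and LU: "adjunction D A L U \<eta> \<epsilon>" and UR: "adjunction A D U R \<eta>' \<epsilon>'"
    and faithful: "faithful_functor A D U"
    and N: "right_exact_functor A A N"
    and NL: "functor_eq D (N \<circ>\<^sub>F L) R"
    and iso: "category_isomorphism (im_cat D A L) (im_cat D A R) (im_restrict N)"
  shows "nakayama_functor A D L U N"
proof -
  interpret A: abelian_category A by fact
  interpret D: additive_category D by fact
  interpret left: faithful_adjunction A D L U \<eta> \<epsilon>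
    using LU faithful by unfold_locales
  interpret right: faithful_adjunction "op_cat A" "op_cat D" R U \<epsilon>' \<eta>'
    using faithful_adjunction_op[OF A D.category_axioms UR faithful] .
  have N_additive: "additive_functor A A N"
    using N unfolding right_exact_functor_def by blast
  have NL_Ob: "fob N (fob L d) = fob R d" if "d \<in> Ob D" for d
    using functor_eqD(1)[OF NL that] by simp
  have ff: "bij_betw (farr N) (Hom A (fob L c) (fob L d)) (Hom A (fob N (fob L c)) (fob N (fob L d)))"
    if "c \<in> Ob D" "d \<in> Ob D" for c d
    using im_restrict_iso_bij_betw[OF iso that] NL_Ob that by simp
  have bij: "bij_betw (farr N) (Hom A X (fob L d)) (Hom A (fob N X) (fob N (fob L d)))"
    if "X \<in> Ob A" "d \<in> Ob D" for X d
    by (rule left.bij_betw_maps_into_image[OF A.preadditive_category_axioms N_additive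
          A.right_exact_preserves_epi[OF N] ff]) (use that in auto)
  have "\<exists>r\<in>Ob A. \<exists>e\<in>Hom A (fob N r) Y.
      \<forall>X\<in>Ob A. \<forall>h\<in>Hom A (fob N X) Y. \<exists>!g. g \<in> Hom A X r \<and> e \<odot>\<^bsub>A\<^esub> farr N g = h"
    if Y: "Y \<in> Ob A" for Y
  proof -
    have UY: "fob U Y \<in> Ob D"
      using left.U_Ob[OF Y] .
    \<comment> \<open>Copresent \<open>Y\<close> in the image of \<open>R\<close> and lift the copresentation along \<open>N\<close> to the image of \<open>L\<close>.\<close>
    obtain d a where d: "d \<in> Ob D" and a: "a \<in> Hom A (fob R (fob U Y)) (fob R d)"
      and ker: "is_kernel A (\<eta>' Y) a"
      using right.counit_is_cokernel[of Y] Y by auto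
    have "a \<in> Hom A (fob N (fob L (fob U Y))) (fob N (fob L d))"
      using a NL_Ob UY d by simp
    then obtain v where v: "v \<in> Hom A (fob L (fob U Y)) (fob L d)" and Nv: "farr N v = a"
      using ff[OF UY d] unfolding bij_betw_def by (metis imageE)
    have "Dom A (\<eta>' Y) = Y"
      using right.counit_Hom[of Y] Y A.HomD(4) by auto
    moreover have "inj_on (farr N) (Hom A X (fob L d))" if "X \<in> Ob A" for X
      using bij[OF that d] unfolding bij_betw_def by blast
    ultimately show ?thesis
      using universal_arrow_from_kernel[OF A A.preadditive_category_axioms N_additive v, of "\<eta>' Y"]
        bij[OF _ UY] ker Nv by simp
  qed
  from right_adjoint_from_universal_arrows[OF A.preadditive_category_axioms
      A.preadditive_category_axioms N_additive this]
  obtain M lam \<sigma> where NM: "adjunction A A N M lam \<sigma>"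
    by blast
  have "is_left_adjoint A D U (N \<circ>\<^sub>F L)"
  proof (rule is_left_adjoint_cong_right[OF A.preadditive_category_axioms D.preadditive_category_axioms])
    show "functor_eq D R (N \<circ>\<^sub>F L)"
      using NL by (simp add: functor_eq_def)
    show "is_left_adjoint A D U R"
      using UR unfolding is_left_adjoint_def by blast
  qed
  moreover have "nat_iso D A L (M \<circ>\<^sub>F N \<circ>\<^sub>F L) (precompose lam L)"
    unfolding nat_iso_def nat_trans_def precompose_def fob_comp farr_comp
  proof (intro conjI ballI)
    fix d assume d: "d \<in> Ob D"
    show "lam (fob L d) \<in> Hom A (fob L d) (fob M (fob N (fob L d)))"
      using A.nat_trans_Hom[OF adjunctionD(3)[OF NM] left.L_Ob[OF d]] by simp
    show "is_iso A (lam (fob L d))"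
      using unit_is_iso[OF A.category_axioms A.category_axioms NM left.L_Ob[OF d]] bij[OF _ d]
      by blast
  next
    fix c d g assume g: "g \<in> Hom D c d"
    show "lam (fob L d) \<odot>\<^bsub>A\<^esub> farr L g = farr M (farr N (farr L g)) \<odot>\<^bsub>A\<^esub> lam (fob L c)"
      using A.nat_trans_natural[OF adjunctionD(3)[OF NM] D.functor_Hom[OF left.L_additive g]] by simp
  qed
  ultimately show ?thesis
    using NM unfolding nakayama_functor_def by blast
qed

text \<open>
  Unit and counit are the transformations forced by their normalisation. To check
  \<open>\<sigma> (N X) \<circ> N (lam X) = 1\<close>, precompose with the epimorphism \<open>N (\<epsilon> X)\<close>: by the defining equation of \<open>lam\<close>
  and naturality of \<open>\<sigma>\<close>, the left-hand side becomes \<open>N (\<epsilon> X) \<circ> \<sigma> (R (U X))\<close>, and \<open>\<sigma>\<close> is the identity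
  there. The other triangle identity is tested by postcomposing with the monomorphism \<open>M (\<eta>' Y)\<close>.
\<close>

lemma adjunction_of_inverses_on_images:
  assumes A: "abelian_category A" and "category D"
    and LU: "adjunction D A L U \<eta> \<epsilon>" and UR: "adjunction A D U R \<eta>' \<epsilon>'"
    and faithful: "faithful_functor A D U"
    and N: "additive_functor A A N" and N_epi: "\<And>p. is_epi A p \<Longrightarrow> is_epi A (farr N p)"
    and M: "additive_functor A A M" and M_mono: "\<And>m. is_mono A m \<Longrightarrow> is_mono A (farr M m)"
    and NL: "\<And>d. d \<in> Ob D \<Longrightarrow> fob N (fob L d) = fob R d"
    and MR: "\<And>d. d \<in> Ob D \<Longrightarrow> fob M (fob R d) = fob L d"
    and MN: "\<And>c d g. c \<in> Ob D \<Longrightarrow> d \<in> Ob D \<Longrightarrow> g \<in> Hom A (fob L c) (fob L d) \<Longrightarrow> farr M (farr N g) = g"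
    and NM: "\<And>c d h. c \<in> Ob D \<Longrightarrow> d \<in> Ob D \<Longrightarrow> h \<in> Hom A (fob R c) (fob R d) \<Longrightarrow> farr N (farr M h) = h"
  shows "\<exists>lam \<sigma>. adjunction A A N M lam \<sigma> \<and>
    nat_eq D (precompose lam L) (id_nat A L) \<and> nat_eq D (precompose \<sigma> R) (id_nat A R) \<and>
    (\<forall>lam'. nat_trans A A id_functor (M \<circ>\<^sub>F N) lam' \<and> nat_eq D (precompose lam' L) (id_nat A L) \<longrightarrow>
      nat_eq A lam' lam) \<and>
    (\<forall>\<sigma>'. nat_trans A A (N \<circ>\<^sub>F M) id_functor \<sigma>' \<and> nat_eq D (precompose \<sigma>' R) (id_nat A R) \<longrightarrow>
      nat_eq A \<sigma>' \<sigma>)"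
proof -
  interpret A: abelian_category A by fact
  interpret D: category D by fact
  interpret left: faithful_adjunction A D L U \<eta> \<epsilon>
    using LU faithful by unfold_locales
  interpret right: faithful_adjunction "op_cat A" "op_cat D" R U \<epsilon>' \<eta>'
    using faithful_adjunction_op[OF A D.category_axioms UR faithful] .
  have unit_Hom: "\<eta>' Y \<in> Hom A Y (fob R (fob U Y))" and unit_mono: "is_mono A (\<eta>' Y)" if "Y \<in> Ob A" for Y
    using right.counit_Hom[of Y] right.counit_is_epi[of Y] that by simp_all
  have MN_additive: "additive_functor A A (M \<circ>\<^sub>F N)"
    using A.additive_functor_comp[OF N M A.category_axioms] .
  have NM_additive: "additive_functor (op_cat A) (op_cat A) (N \<circ>\<^sub>F M)"
    using additive_functor_op[OF A.additive_functor_comp[OF M N A.category_axioms]] .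
  have MN_Ob: "fob (M \<circ>\<^sub>F N) (fob L d) = fob L d" if "d \<in> Ob D" for d
    using NL[OF that] MR[OF that] by simp
  have NM_Ob: "fob (N \<circ>\<^sub>F M) (fob R d) = fob R d" if "d \<in> Ob D" for d
    using NL[OF that] MR[OF that] by simp
  obtain lam where lam: "nat_trans A A id_functor (M \<circ>\<^sub>F N) lam"
    and lam_L: "\<And>d. d \<in> Ob D \<Longrightarrow> lam (fob L d) = Id A (fob L d)"
    using left.nat_trans_from_id_exists[OF MN_additive MN_Ob] MN by auto
  obtain \<sigma> where \<sigma>_op: "nat_trans (op_cat A) (op_cat A) id_functor (N \<circ>\<^sub>F M) \<sigma>"
    and \<sigma>_R: "\<And>d. d \<in> Ob D \<Longrightarrow> \<sigma> (fob R d) = Id A (fob R d)"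
    using right.nat_trans_from_id_exists[OF NM_additive] NM_Ob NM by auto
  have \<sigma>: "nat_trans A A (N \<circ>\<^sub>F M) id_functor \<sigma>"
    using nat_trans_op[OF \<sigma>_op] by simp
  have lam_Hom: "lam X \<in> Hom A X (fob M (fob N X))" and \<sigma>_Hom: "\<sigma> X \<in> Hom A (fob N (fob M X)) X"
    if "X \<in> Ob A" for X
    using A.nat_trans_Hom[OF lam that] A.nat_trans_Hom[OF \<sigma> that] by simp_all
  have "adjunction A A N M lam \<sigma>"
    unfolding adjunction_def
  proof (intro conjI ballI N M lam \<sigma>)
    fix X assume X: "X \<in> Ob A"
    note \<epsilon>X = left.counit_Hom[OF X] and UX = left.U_Ob[OF X] and NX = A.functor_Ob[OF N X]
    note N\<epsilon> = A.functor_Hom[OF N \<epsilon>X] and N_lam = A.functor_Hom[OF N lam_Hom[OF X]]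
    have "(\<sigma> (fob N X) \<odot>\<^bsub>A\<^esub> farr N (lam X)) \<odot>\<^bsub>A\<^esub> farr N (\<epsilon> X) =
        \<sigma> (fob N X) \<odot>\<^bsub>A\<^esub> farr N (lam X \<odot>\<^bsub>A\<^esub> \<epsilon> X)"
      using A.Comp_assoc[OF N\<epsilon> N_lam \<sigma>_Hom[OF NX]] A.functor_Comp[OF N \<epsilon>X lam_Hom[OF X]] by simp
    also have "\<dots> = \<sigma> (fob N X) \<odot>\<^bsub>A\<^esub> farr N (farr M (farr N (\<epsilon> X)))"
      using left.nat_trans_from_id_counit[OF lam lam_L MN_additive MN_Ob X] by simp
    also have "\<dots> = farr N (\<epsilon> X) \<odot>\<^bsub>A\<^esub> \<sigma> (fob N (fob L (fob U X)))"
      using A.nat_trans_natural[OF \<sigma> N\<epsilon>] by simp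
    also have "\<dots> = Id A (fob N X) \<odot>\<^bsub>A\<^esub> farr N (\<epsilon> X)"
      using \<sigma>_R[OF UX] NL[OF UX] N\<epsilon> A.Comp_Id[OF N\<epsilon>] A.Id_Comp[OF N\<epsilon>] by simp
    finally show "\<sigma> (fob N X) \<odot>\<^bsub>A\<^esub> farr N (lam X) = Id A (fob N X)"
      by (rule A.epiD[OF N_epi[OF left.counit_is_epi[OF X]] N\<epsilon>
            A.Comp_closed[OF N_lam \<sigma>_Hom[OF NX]] A.Id_closed[OF NX]])
  next
    fix Y assume Y: "Y \<in> Ob A"
    note \<eta>Y = unit_Hom[OF Y] and UY = left.U_Ob[OF Y] and MY = A.functor_Ob[OF M Y]
    note M\<eta> = A.functor_Hom[OF M \<eta>Y] and M_\<sigma> = A.functor_Hom[OF M \<sigma>_Hom[OF Y]]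
    have "farr M (\<eta>' Y) \<odot>\<^bsub>A\<^esub> (farr M (\<sigma> Y) \<odot>\<^bsub>A\<^esub> lam (fob M Y)) =
        farr M (\<eta>' Y \<odot>\<^bsub>A\<^esub> \<sigma> Y) \<odot>\<^bsub>A\<^esub> lam (fob M Y)"
      using A.Comp_assoc[OF lam_Hom[OF MY] M_\<sigma> M\<eta>] A.functor_Comp[OF M \<sigma>_Hom[OF Y] \<eta>Y] by simp
    also have "\<dots> = farr M (farr N (farr M (\<eta>' Y))) \<odot>\<^bsub>A\<^esub> lam (fob M Y)"
      using right.nat_trans_from_id_counit[OF \<sigma>_op _ NM_additive, of Y] \<sigma>_R NM_Ob Y by simp
    also have "\<dots> = lam (fob M (fob R (fob U Y))) \<odot>\<^bsub>A\<^esub> farr M (\<eta>' Y)"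
      using A.nat_trans_natural[OF lam M\<eta>] by simp
    also have "\<dots> = farr M (\<eta>' Y) \<odot>\<^bsub>A\<^esub> Id A (fob M Y)"
      using lam_L[OF UY] MR[OF UY] A.Comp_Id[OF M\<eta>] A.Id_Comp[OF M\<eta>] by simp
    finally show "farr M (\<sigma> Y) \<odot>\<^bsub>A\<^esub> lam (fob M Y) = Id A (fob M Y)"
      by (rule A.monoD[OF M_mono[OF unit_mono[OF Y]] M\<eta>
            A.Comp_closed[OF lam_Hom[OF MY] M_\<sigma>] A.Id_closed[OF MY]])
  qed
  moreover have "nat_eq A lam' lam"
    if "nat_trans A A id_functor (M \<circ>\<^sub>F N) lam'" "nat_eq D (precompose lam' L) (id_nat A L)" for lam'
    using left.nat_trans_from_id_unique[OF MN_additive MN_Ob that(1) _ lam lam_L] that(2)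
    by (simp add: nat_eq_def precompose_def id_nat_def)
  moreover have "nat_eq A \<sigma>' \<sigma>"
    if "nat_trans A A (N \<circ>\<^sub>F M) id_functor \<sigma>'" "nat_eq D (precompose \<sigma>' R) (id_nat A R)" for \<sigma>'
    using right.nat_trans_from_id_unique[OF NM_additive _ nat_trans_op[OF that(1)] _ \<sigma>_op] NM_Ob \<sigma>_R that(2)
    by (simp add: nat_eq_def precompose_def id_nat_def)
  moreover have "nat_eq D (precompose lam L) (id_nat A L)" "nat_eq D (precompose \<sigma> R) (id_nat A R)"
    using lam_L \<sigma>_R by (simp_all add: nat_eq_def precompose_def id_nat_def)
  ultimately show ?thesis by blast
qed

theorem corollary3p3p2:
  fixes A :: "('a, 'm) precat" and D :: "('d, 'n) precat"
    and f_shriek f_low :: "('d, 'n, 'a, 'm) cfunctor"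
    and f_up :: "('a, 'm, 'd, 'n) cfunctor"
    and \<nu> :: "('a, 'm, 'a, 'm) cfunctor"
  assumes "abelian_category A" and "additive_category D"
    and "is_left_adjoint D A f_shriek f_up"
    and "is_left_adjoint A D f_up f_low"
    and "faithful_functor A D f_up"
    and "right_exact_functor A A \<nu>"
    and "functor_eq D (\<nu> \<circ>\<^sub>F f_shriek) f_low"
    and "category_isomorphism (im_cat D A f_shriek) (im_cat D A f_low) (im_restrict \<nu>)"
  shows "nakayama_functor A D f_shriek f_up \<nu> \<and>
    (\<forall>\<nu>_minus :: ('a, 'm, 'a, 'm) cfunctor.
       left_exact_functor A A \<nu>_minus \<and>
       functor_eq D (\<nu>_minus \<circ>\<^sub>F f_low) f_shriek \<and>
       inverse_functors (im_cat D A f_shriek) (im_cat D A f_low) (im_restrict \<nu>) (im_restrict \<nu>_minus)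
       \<longrightarrow>
       is_left_adjoint A A \<nu> \<nu>_minus \<and>
       (\<exists>lam \<sigma>.
          adjunction A A \<nu> \<nu>_minus lam \<sigma> \<and>
          nat_eq D (precompose lam f_shriek) (id_nat A f_shriek) \<and>
          nat_eq D (precompose \<sigma> f_low) (id_nat A f_low) \<and>
          (\<forall>lam'. nat_trans A A id_functor (\<nu>_minus \<circ>\<^sub>F \<nu>) lam' \<and>
                 nat_eq D (precompose lam' f_shriek) (id_nat A f_shriek) \<longrightarrow> nat_eq A lam' lam) \<and>
          (\<forall>\<sigma>'. nat_trans A A (\<nu> \<circ>\<^sub>F \<nu>_minus) id_functor \<sigma>' \<and>
                 nat_eq D (precompose \<sigma>' f_low) (id_nat A f_low) \<longrightarrow> nat_eq A \<sigma>' \<sigma>)))"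
proof -
  interpret A: abelian_category A by fact
  interpret D: additive_category D by fact
  obtain \<eta> \<epsilon> where LU: "adjunction D A f_shriek f_up \<eta> \<epsilon>"
    using assms(3) unfolding is_left_adjoint_def by blast
  obtain \<eta>' \<epsilon>' where UR: "adjunction A D f_up f_low \<eta>' \<epsilon>'"
    using assms(4) unfolding is_left_adjoint_def by blast
  have nakayama: "nakayama_functor A D f_shriek f_up \<nu>"
    using nakayama_functor_of_iso_on_image[OF assms(1,2) LU UR assms(5-8)] .
  have adjoint: "\<exists>lam \<sigma>. adjunction A A \<nu> \<nu>_minus lam \<sigma> \<and>
      nat_eq D (precompose lam f_shriek) (id_nat A f_shriek) \<and>
      nat_eq D (precompose \<sigma> f_low) (id_nat A f_low) \<and>
      (\<forall>lam'. nat_trans A A id_functor (\<nu>_minus \<circ>\<^sub>F \<nu>) lam' \<and>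
        nat_eq D (precompose lam' f_shriek) (id_nat A f_shriek) \<longrightarrow> nat_eq A lam' lam) \<and>
      (\<forall>\<sigma>'. nat_trans A A (\<nu> \<circ>\<^sub>F \<nu>_minus) id_functor \<sigma>' \<and>
        nat_eq D (precompose \<sigma>' f_low) (id_nat A f_low) \<longrightarrow> nat_eq A \<sigma>' \<sigma>)"
    if left_exact: "left_exact_functor A A \<nu>_minus" and eq: "functor_eq D (\<nu>_minus \<circ>\<^sub>F f_low) f_shriek"
      and inv: "inverse_functors (im_cat D A f_shriek) (im_cat D A f_low) (im_restrict \<nu>) (im_restrict \<nu>_minus)"
    for \<nu>_minus :: "('a, 'm, 'a, 'm) cfunctor"
  proof (rule adjunction_of_inverses_on_images[OF assms(1) D.category_axioms LU UR assms(5)])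
    show "additive_functor A A \<nu>" "additive_functor A A \<nu>_minus"
      using assms(6) left_exact unfolding right_exact_functor_def left_exact_functor_def by blast+
    show "is_epi A (farr \<nu> p)" if "is_epi A p" for p
      using A.right_exact_preserves_epi[OF assms(6) that] .
    show "is_mono A (farr \<nu>_minus m)" if "is_mono A m" for m
      using A.left_exact_preserves_mono[OF left_exact that] .
    show "fob \<nu> (fob f_shriek d) = fob f_low d" "fob \<nu>_minus (fob f_low d) = fob f_shriek d"
      if "d \<in> Ob D" for d
      using functor_eqD(1)[OF assms(7) that] functor_eqD(1)[OF eq that] by simp_all
  qed (use im_restrict_inverseD[OF inv] in blast)+
  show ?thesis
  proof (intro conjI allI impI nakayama)
    fix \<nu>_minus :: "('a, 'm, 'a, 'm) cfunctor"
    assume "left_exact_functor A A \<nu>_minus \<and> functor_eq D (\<nu>_minus \<circ>\<^sub>F f_low) f_shriek \<and>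
      inverse_functors (im_cat D A f_shriek) (im_cat D A f_low) (im_restrict \<nu>) (im_restrict \<nu>_minus)"
    with adjoint show "\<exists>lam \<sigma>. adjunction A A \<nu> \<nu>_minus lam \<sigma> \<and>
      nat_eq D (precompose lam f_shriek) (id_nat A f_shriek) \<and>
      nat_eq D (precompose \<sigma> f_low) (id_nat A f_low) \<and>
      (\<forall>lam'. nat_trans A A id_functor (\<nu>_minus \<circ>\<^sub>F \<nu>) lam' \<and>
        nat_eq D (precompose lam' f_shriek) (id_nat A f_shriek) \<longrightarrow> nat_eq A lam' lam) \<and>
      (\<forall>\<sigma>'. nat_trans A A (\<nu> \<circ>\<^sub>F \<nu>_minus) id_functor \<sigma>' \<and>
        nat_eq D (precompose \<sigma>' f_low) (id_nat A f_low) \<longrightarrow> nat_eq A \<sigma>' \<sigma>)"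
      by blast
    then show "is_left_adjoint A A \<nu> \<nu>_minus"
      unfolding is_left_adjoint_def by blast
  qed
qed

end
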